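(* There is a deterministic $\mathsf{CONGEST}$ algorithm that solves the list-coloring problem on every instance consisting of an $n$-node graph $G=(V,E)$, a color space $[C]$, and lists $L(v)\subseteq[C]$ with $|L(v)|\ge\deg(v)+1$ for all $v\in V$, in $O(\log^8 n)$ rounds.
   Context: $[C]:=\{0,\dots,C-1\}$. Given a graph $G=(V,E)$, a color space $[C]$ and lists $L(v)\subseteq[C]$ for $v\in V$, a list-coloring is a map $\phi:V\to[C]$ with $\phi(v)\in L(v)$ for all $v\in V$ and $\phi(u)\ne\phi(v)$ for every edge $\{u,v\}\in E$. $\mathsf{CONGEST}$ model: the communication network is the $n$-node graph $G$; nodes have unique identifiers of $O(\log n)$ bits. Time proceeds in synchronous rounds; in each round every node performs arbitrary internal computation and sends a message of $O(\log n)$ bits to each of its neighbors. Initially a node knows only its own input (its identifier, its list $L(v)$), the identifiers of its neighbors, and global parameters; at the end each node must know its own color. The time complexity is the number of rounds. Standing assumption: $C\le\mathrm{poly}(n)$, so that a color fits into $O(1)$ messages. *)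

theory Defs
  imports Complex_Main "HOL-Library.Landau_Symbols"
begin

section \<open>List coloring\<close>

text \<open>
  In the model, nodes carry unique identifiers, so a node is represented by its identifier (a natural
  number). This is no restriction: an injective assignment of identifiers to the nodes of any finite
  graph renames that graph to one of this form.
\<close>

record coloring_instance =
  nodes :: "nat set"
  edges :: "nat set set"
  num_colors :: nat
  palette :: "nat \<Rightarrow> nat set"

definition well_formed :: "coloring_instance \<Rightarrow> bool" where
  "well_formed I \<longleftrightarrow>
     finite (nodes I) \<and>
     edges I \<subseteq> {{u, v} | u v. u \<in> nodes I \<and> v \<in> nodes I \<and> u \<noteq> v} \<and>
     (\<forall>v \<in> nodes I. palette I v \<subseteq> {0..<num_colors I})"

definition neighbors :: "coloring_instance \<Rightarrow> nat \<Rightarrow> nat set" where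
  "neighbors I v = {u. {u, v} \<in> edges I}"

definition degree :: "coloring_instance \<Rightarrow> nat \<Rightarrow> nat" where
  "degree I v = card (neighbors I v)"

definition list_coloring :: "coloring_instance \<Rightarrow> (nat \<Rightarrow> nat) \<Rightarrow> bool" where
  "list_coloring I \<phi> \<longleftrightarrow>
     (\<forall>v \<in> nodes I. \<phi> v \<in> palette I v) \<and>
     (\<forall>u v. {u, v} \<in> edges I \<longrightarrow> \<phi> u \<noteq> \<phi> v)"

section \<open>Deterministic CONGEST algorithms\<close>

text \<open>
  Everything a node knows before the first round. The global parameters are the number of nodes
  and the size of the color space (in particular, the maximum degree is not given).
\<close>

record local_input =
  in_num_nodes :: nat
  in_num_colors :: nat
  in_id :: nat
  in_neighbor_ids :: "nat set"
  in_palette :: "nat set"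

definition local_input_of :: "coloring_instance \<Rightarrow> nat \<Rightarrow> local_input" where
  "local_input_of I v =
     \<lparr>in_num_nodes = card (nodes I), in_num_colors = num_colors I, in_id = v,
      in_neighbor_ids = neighbors I v, in_palette = palette I v\<rparr>"

type_synonym message = "bool list"

text \<open>
  The messages a node received in the rounds so far, oldest round first; each round is a map from
  the identifiers of the neighbors to the messages they sent.
\<close>

type_synonym history = "(nat \<rightharpoonup> message) list"

text \<open>
  Internal computation is unrestricted and deterministic, so any internal state of a node is a
  function of its local input and its history. An algorithm is therefore given by
  the message a node sends next to the neighbor with a given identifier, and by the color it
  outputs, as arbitrary functions of these data. The same functions are used at all nodes
  and for all instances.
\<close>

record congest_algorithm =
  send :: "local_input \<Rightarrow> history \<Rightarrow> nat \<Rightarrow> message"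
  output_color :: "local_input \<Rightarrow> history \<Rightarrow> nat"

primrec history_after :: "congest_algorithm \<Rightarrow> coloring_instance \<Rightarrow> nat \<Rightarrow> nat \<Rightarrow> history" where
  "history_after A I 0 v = []"
| "history_after A I (Suc t) v =
     history_after A I t v @
       [\<lambda>u. if u \<in> neighbors I v
            then Some (send A (local_input_of I u) (history_after A I t u) v)
            else None]"

definition output_after :: "congest_algorithm \<Rightarrow> coloring_instance \<Rightarrow> nat \<Rightarrow> nat \<Rightarrow> nat" where
  "output_after A I T v = output_color A (local_input_of I v) (history_after A I T v)"

text \<open>In each of the first \<open>T\<close> rounds, every message consists of at most \<open>B\<close> bits.\<close>

definition respects_bandwidth :: "congest_algorithm \<Rightarrow> coloring_instance \<Rightarrow> nat \<Rightarrow> nat \<Rightarrow> bool" where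
  "respects_bandwidth A I T B \<longleftrightarrow>
     (\<forall>t < T. \<forall>v \<in> nodes I. \<forall>u \<in> neighbors I v.
        length (send A (local_input_of I v) (history_after A I t v) u) \<le> B)"

end

theory Submission
  imports Defs "HOL-Library.FuncSet"
begin

text \<open>
  Let \<open>L = O(log n)\<close> bound the number of bits of identifiers, colors and \<open>n\<close>. In each of \<open>O(L)\<close> phases the
  undecided nodes fix a candidate color bit by bit, most significant bit first. If \<open>k v\<close> is the number of
  available colors of \<open>v\<close> that extend its current prefix, the energy \<open>\<Sum>(1 / k u + 1 / k v)\<close> over ordered
  pairs of adjacent undecided nodes with equal prefixes is initially at most twice the number of undecided
  nodes, as \<open>k v > deg v\<close>, and choosing each bit at random in proportion to the number of extensions
  preserves its expectation. This is derandomized by conditional expectations along a defective coloring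
  with \<open>O(L ^ 5)\<close> classes: a code of large distance turns identifiers into words, and each node picks the
  position of its word at which the least weight of its edges is monochromatic. With errors of
  \<open>O(1 / L)\<close> per bit the final energy, twice the number of ordered conflicting pairs, is at most three
  times the number of undecided nodes. So there are at most 3/4 as many conflict edges as undecided nodes,
  and if every edge eliminates its endpoint of smaller identifier, a quarter of these nodes can keep their
  candidates. The total is \<open>O(L ^ 7)\<close> rounds.
\<close>

section \<open>Codes of large distance\<close>

text \<open>An exponential moment bound: each word is weighted by 2 to the number of its agreements
  with \<open>c\<close>. The sum of the weights factorizes over the positions, and each position
  contributes \<open>(s - 1) + 2 = s + 1\<close>.\<close>

lemma card_agreeing_words_le:
  fixes c :: "'a \<Rightarrow> nat"
  assumes "finite A" "c \<in> A \<rightarrow> {..<s}"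
  shows "card {w \<in> A \<rightarrow>\<^sub>E {..<s}. t \<le> card {i \<in> A. w i = c i}} * 2 ^ t \<le> (s + 1) ^ card A"
proof -
  let ?W = "A \<rightarrow>\<^sub>E {..<s}"
  let ?B = "{w \<in> ?W. t \<le> card {i \<in> A. w i = c i}}"
  have fin: "finite ?W" using assms(1) by (intro finite_PiE) auto
  have pow: "(\<Prod>i\<in>A. if w i = c i then 2 else 1) = (2::nat) ^ card {i \<in> A. w i = c i}" for w
    using assms(1) by (simp add: prod.If_cases Int_def)
  have inner: "(\<Sum>x<s. if x = c i then 2 else 1) = s + 1" if "i \<in> A" for i
  proof -
    have "c i < s" using assms(2) that by auto
    have "(\<Sum>x<s. if x = c i then 2 else (1::nat)) = (\<Sum>x<s. 1 + (if x = c i then 1 else 0))"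
      by (intro sum.cong) auto
    also have "\<dots> = s + 1" using \<open>c i < s\<close> by (subst sum.distrib) simp
    finally show ?thesis .
  qed
  have "card ?B * 2 ^ t = (\<Sum>w\<in>?B. 2 ^ t)" by simp
  also have "\<dots> \<le> (\<Sum>w\<in>?B. 2 ^ card {i \<in> A. w i = c i})"
    by (intro sum_mono power_increasing) auto
  also have "\<dots> \<le> (\<Sum>w\<in>?W. 2 ^ card {i \<in> A. w i = c i})"
    using fin by (intro sum_mono2) auto
  also have "\<dots> = (\<Sum>w\<in>?W. \<Prod>i\<in>A. if w i = c i then 2 else 1)"
    by (simp add: pow)
  also have "\<dots> = (\<Prod>i\<in>A. \<Sum>x<s. if x = c i then 2 else 1)"
    using assms(1) by (subst prod_sum_PiE[where B = "\<lambda>_. {..<s}"]) auto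
  also have "\<dots> = (s + 1) ^ card A" by (simp add: inner)
  finally show ?thesis .
qed

text \<open>The greedy argument of Gilbert and Varshamov: codewords are added one at a time, and the
  words too close to an earlier codeword are too few to exhaust all words.\<close>

lemma ex_code:
  fixes A :: "'a set"
  assumes "finite A" "n * (s + 1) ^ card A < 2 ^ t * s ^ card A"
  shows "\<exists>code :: nat \<Rightarrow> 'a \<Rightarrow> nat. (\<forall>u<n. code u \<in> A \<rightarrow> {..<s}) \<and>
    (\<forall>u<n. \<forall>v<n. u \<noteq> v \<longrightarrow> card {i \<in> A. code u i = code v i} < t)"
  using assms(2)
proof (induction n)
  case 0
  then show ?case by simp
next
  case (Suc n)
  have less: "n * (s + 1) ^ card A < 2 ^ t * s ^ card A"
    using Suc.prems by (rule le_less_trans[rotated]) simp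
  from less obtain code :: "nat \<Rightarrow> 'a \<Rightarrow> nat" where
    code: "\<And>u. u < n \<Longrightarrow> code u \<in> A \<rightarrow> {..<s}"
      "\<And>u v. u < n \<Longrightarrow> v < n \<Longrightarrow> u \<noteq> v \<Longrightarrow> card {i \<in> A. code u i = code v i} < t"
    using Suc.IH by blast
  let ?W = "A \<rightarrow>\<^sub>E {..<s}"
  let ?B = "\<lambda>u. {w \<in> ?W. t \<le> card {i \<in> A. w i = code u i}}"
  have "card (\<Union>u<n. ?B u) * 2 ^ t \<le> (\<Sum>u<n. card (?B u)) * 2 ^ t"
    by (intro mult_right_mono card_UN_le) auto
  also have "\<dots> \<le> n * (s + 1) ^ card A"
    unfolding sum_distrib_right
    using sum_bounded_above[of "{..<n}" "\<lambda>u. card (?B u) * 2 ^ t" "(s + 1) ^ card A"]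
      card_agreeing_words_le[OF assms(1) code(1)] by simp
  also have "\<dots> < card ?W * 2 ^ t"
    using less assms(1) by (simp add: card_PiE mult.commute)
  finally have less_card: "card (\<Union>u<n. ?B u) < card ?W" by simp
  have finite_B: "finite (\<Union>u<n. ?B u)"
    using finite_PiE[OF assms(1), of "\<lambda>_. {..<s}"] by simp
  have "\<not> ?W \<subseteq> (\<Union>u<n. ?B u)"
    by (rule notI) (rule notE[OF leD[OF card_mono[OF finite_B]] less_card])
  then obtain w where w: "w \<in> ?W" "w \<notin> (\<Union>u<n. ?B u)" by blast
  have wu: "card {i \<in> A. w i = code u i} < t" "card {i \<in> A. code u i = w i} < t" if "u < n" for u
  proof -
    show *: "card {i \<in> A. w i = code u i} < t"
      using w that by (simp add: not_le)
    have "{i \<in> A. code u i = w i} = {i \<in> A. w i = code u i}" by auto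
    then show "card {i \<in> A. code u i = w i} < t" using * by simp
  qed
  have "w \<in> A \<rightarrow> {..<s}" using w(1) by (simp add: PiE_def)
  then have "(\<forall>u<Suc n. (code(n := w)) u \<in> A \<rightarrow> {..<s}) \<and>
    (\<forall>u<Suc n. \<forall>v<Suc n. u \<noteq> v \<longrightarrow> card {i \<in> A. (code(n := w)) u i = (code(n := w)) v i} < t)"
    using code wu by (simp add: less_Suc_eq)
  then show ?case by blast
qed

text \<open>
  Two codewords agree in a fraction of less than \<open>4 / alphabet_size L\<close> of the positions; this is the
  square of \<open>clip L\<close> below.
\<close>

definition alphabet_size :: "nat \<Rightarrow> nat" where "alphabet_size L = 576 * L\<^sup>2"

definition word_length :: "nat \<Rightarrow> nat" where "word_length L = alphabet_size L * L"

definition separating_code :: "nat \<Rightarrow> (nat \<Rightarrow> nat \<Rightarrow> nat) \<Rightarrow> bool" where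
  "separating_code L code \<longleftrightarrow>
     (\<forall>u<2^L. \<forall>i<word_length L. code u i < alphabet_size L) \<and>
     (\<forall>u<2^L. \<forall>v<2^L. u \<noteq> v \<longrightarrow> card {i \<in> {..<word_length L}. code u i = code v i} < 4 * L)"

text \<open>With alphabet size \<open>s\<close>, the bound
  \<open>(1 + 1 / s) ^ s \<le> exp 1 \<le> 4\<close> gives
  \<open>(s + 1) ^ (s * L) \<le> 2 ^ (2 * L) * s ^ (s * L)\<close>. Together with the
  \<open>2 ^ L\<close> codewords this costs \<open>2 ^ (3 * L)\<close>, which is below the
  \<open>2 ^ t\<close> of \<open>ex_code\<close> for \<open>t = 4 * L\<close>.\<close>

lemma ex_separating_code:
  assumes "L > 0"
  shows "\<exists>code. separating_code L code"
proof -
  define s where "s = alphabet_size L"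
  have s: "s > 0" using assms by (simp add: s_def alphabet_size_def)
  have "((real s + 1) / real s) ^ s = (1 + 1 / real s) ^ s" using s by (simp add: field_simps)
  also have "\<dots> \<le> exp (1 / real s) ^ s" by (intro power_mono) (auto intro: exp_ge_add_one_self)
  also have "\<dots> = exp 1" using s by (simp flip: exp_of_nat_mult)
  also have "\<dots> \<le> 2 ^ 2" using exp_le by simp
  finally have "(real s + 1) ^ s \<le> 2 ^ 2 * real s ^ s" using s by (simp add: power_divide field_simps)
  then have "real ((s + 1) ^ s) \<le> real (2 ^ 2 * s ^ s)" by (simp add: add.commute)
  then have "(s + 1) ^ s \<le> 2 ^ 2 * s ^ s" by (simp only: of_nat_le_iff)
  then have "((s + 1) ^ s) ^ L \<le> (2 ^ 2 * s ^ s) ^ L" by (rule power_mono) simp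
  then have "(s + 1) ^ (s * L) \<le> 2 ^ (2 * L) * s ^ (s * L)"
    by (simp only: power_mult power_mult_distrib)
  moreover have triple: "(2::nat) ^ (3 * L) = 2 ^ L * 2 ^ (2 * L)" by (simp flip: power_add)
  ultimately have "2 ^ L * (s + 1) ^ (s * L) \<le> 2 ^ (3 * L) * s ^ (s * L)"
    unfolding triple mult.assoc by (intro mult_left_mono) simp_all
  also have "\<dots> < 2 ^ (4 * L) * s ^ (s * L)"
    using s assms by simp
  finally have "2 ^ L * (s + 1) ^ card {..<word_length L} < 2 ^ (4 * L) * s ^ card {..<word_length L}"
    by (simp add: word_length_def s_def)
  from ex_code[OF _ this] obtain code :: "nat \<Rightarrow> nat \<Rightarrow> nat" where
    "\<forall>u<2^L. code u \<in> {..<word_length L} \<rightarrow> {..<s}"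
    "\<forall>u<2^L. \<forall>v<2^L. u \<noteq> v \<longrightarrow> card {i \<in> {..<word_length L}. code u i = code v i} < 4 * L"
    by auto
  then have "separating_code L code"
    unfolding separating_code_def s_def by (simp add: Pi_iff)
  then show ?thesis by blast
qed

section \<open>Derandomizing the choice of one bit\<close>

text \<open>
  A node with \<open>s x\<close> candidate colors whose next bit is \<open>x\<close> proposes \<open>x\<close> with probability proportional
  to \<open>s x\<close>, except that a fraction below \<open>\<delta>\<close> is rounded to 0. Hence no choice shrinks the candidate set
  by more than a factor \<open>1 / \<delta>\<close>.
\<close>

definition bit_prob :: "real \<Rightarrow> (bool \<Rightarrow> nat) \<Rightarrow> bool \<Rightarrow> real" where
  "bit_prob \<delta> s x =
     (let k = real (s False + s True) in
      if real (s x) < \<delta> * k then 0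
      else if real (s (\<not> x)) < \<delta> * k then 1
      else real (s x) / k)"

text \<open>The contribution of an edge to the energy after its endpoints have fixed the bits
  \<open>x\<close> and \<open>y\<close>; different bits separate the prefixes and remove the
  conflict. The contribution before the bits are fixed is \<open>edge_weight\<close>.\<close>

definition edge_cost :: "(bool \<Rightarrow> nat) \<Rightarrow> (bool \<Rightarrow> nat) \<Rightarrow> bool \<Rightarrow> bool \<Rightarrow> real" where
  "edge_cost r s x y = (if x = y then 1 / real (r x) + 1 / real (s y) else 0)"

definition edge_weight :: "(bool \<Rightarrow> nat) \<Rightarrow> (bool \<Rightarrow> nat) \<Rightarrow> real" where
  "edge_weight r s = 1 / real (r False + r True) + 1 / real (s False + s True)"

lemma edge_cost_commute: "edge_cost r s x y = edge_cost s r y x"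
  by (simp add: edge_cost_def)

lemma edge_cost_nonneg: "edge_cost r s x y \<ge> 0"
  by (simp add: edge_cost_def)

lemma edge_weight_nonneg: "edge_weight r s \<ge> 0"
  by (simp add: edge_weight_def)

context
  fixes \<delta> :: real and s :: "bool \<Rightarrow> nat"
  assumes \<delta>: "0 < \<delta>" "\<delta> \<le> 1 / 3" and s: "s False + s True > 0"
begin

lemma bit_prob_nonneg: "bit_prob \<delta> s x \<ge> 0"
  by (simp add: bit_prob_def Let_def)

lemma size_eq: "real (s False + s True) = real (s x) + real (s (\<not> x))"
  by (cases x) auto

lemma not_both_small: "\<not> (real (s x) < \<delta> * real (s False + s True) \<and> real (s (\<not> x)) < \<delta> * real (s False + s True))"
proof
  assume "real (s x) < \<delta> * real (s False + s True) \<and> real (s (\<not> x)) < \<delta> * real (s False + s True)"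
  then have "real (s False + s True) < 2 * (\<delta> * real (s False + s True))"
    using size_eq[of x] by linarith
  also have "\<dots> \<le> 2 * (1 / 3 * real (s False + s True))"
    using \<delta>(2) by (intro mult_left_mono mult_right_mono) auto
  finally show False by simp
qed

lemma bit_prob_sum: "bit_prob \<delta> s False + bit_prob \<delta> s True = 1"
  using not_both_small[of True] s
  by (auto simp: bit_prob_def Let_def simp flip: add_divide_distrib)

text \<open>Without clipping the quotient is exactly the reciprocal of the total. A probability is
  raised to 1 only if the other bit has less than a fraction \<open>\<delta>\<close> of the colors,
  and then \<open>1 \<le> (1 + 2 * \<delta>) * (1 - \<delta>)\<close> absorbs the loss.\<close>

lemma bit_prob_le: "bit_prob \<delta> s x / real (s x) \<le> (1 + 2 * \<delta>) / real (s False + s True)"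
proof -
  let ?k = "real (s False + s True)"
  have k: "?k > 0" using s by (simp del: of_nat_add)
  show ?thesis
  proof (cases "bit_prob \<delta> s x = 0 \<or> s x = 0")
    case True
    then show ?thesis using k \<delta> by auto
  next
    case False
    then have nz: "\<not> real (s x) < \<delta> * ?k" "real (s x) > 0" by (auto simp: bit_prob_def Let_def)
    show ?thesis
    proof (cases "real (s (\<not> x)) < \<delta> * ?k")
      case True
      then have p: "bit_prob \<delta> s x = 1" using nz by (simp add: bit_prob_def Let_def)
      have "0 \<le> \<delta> * (1 - 2 * \<delta>)" using \<delta> by simp
      then have "1 \<le> (1 + 2 * \<delta>) * (1 - \<delta>)" by (simp add: algebra_simps)
      then have "1 * ?k \<le> (1 + 2 * \<delta>) * (1 - \<delta>) * ?k" using k by (intro mult_right_mono) auto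
      also have "\<dots> = (1 + 2 * \<delta>) * (?k - \<delta> * ?k)" by (simp add: algebra_simps)
      also have "\<dots> \<le> (1 + 2 * \<delta>) * real (s x)"
        using True size_eq[of x] \<delta> by (intro mult_left_mono) auto
      finally have "?k \<le> (1 + 2 * \<delta>) * real (s x)" by simp
      then show ?thesis unfolding p using k nz by (simp add: field_simps)
    next
      case False
      then have "bit_prob \<delta> s x / real (s x) = 1 / ?k" using nz by (simp add: bit_prob_def Let_def)
      also have "\<dots> \<le> (1 + 2 * \<delta>) / ?k" using k \<delta> by (intro divide_right_mono) auto
      finally show ?thesis .
    qed
  qed
qed

lemma size_ge_if_bit_prob_pos:
  "bit_prob \<delta> s x > 0 \<Longrightarrow> \<delta> * real (s False + s True) \<le> real (s x)"
  by (auto simp: bit_prob_def Let_def split: if_splits)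

end

text \<open>For independent bits, the reciprocal belonging to one endpoint is bounded by
  \<open>bit_prob_le\<close> whatever the common bit is, and the probabilities of the other endpoint
  sum to 1.\<close>

lemma expected_edge_cost_le:
  assumes \<delta>: "0 < \<delta>" "\<delta> \<le> 1 / 3" and "r False + r True > 0" "s False + s True > 0"
  shows "(\<Sum>x\<in>UNIV. \<Sum>y\<in>UNIV. bit_prob \<delta> r x * bit_prob \<delta> s y * edge_cost r s x y)
    \<le> (1 + 2 * \<delta>) * edge_weight r s"
proof -
  let ?p = "bit_prob \<delta> r" and ?q = "bit_prob \<delta> s"
  note p = bit_prob_nonneg[OF \<delta> assms(3)] bit_prob_le[OF \<delta> assms(3)] bit_prob_sum[OF \<delta> assms(3)]
  note q = bit_prob_nonneg[OF \<delta> assms(4)] bit_prob_le[OF \<delta> assms(4)] bit_prob_sum[OF \<delta> assms(4)]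
  have "(\<Sum>x\<in>UNIV. \<Sum>y\<in>UNIV. ?p x * ?q y * edge_cost r s x y)
      = (\<Sum>x\<in>UNIV. ?q x * (?p x / real (r x))) + (\<Sum>x\<in>UNIV. ?p x * (?q x / real (s x)))"
    by (simp add: UNIV_bool edge_cost_def algebra_simps)
  also have "\<dots> \<le> (\<Sum>x\<in>UNIV. ?q x * ((1 + 2 * \<delta>) / real (r False + r True)))
      + (\<Sum>x\<in>UNIV. ?p x * ((1 + 2 * \<delta>) / real (s False + s True)))"
    by (intro add_mono sum_mono mult_left_mono p q)
  also have "\<dots> = (1 + 2 * \<delta>) * edge_weight r s"
    using p(3) q(3) by (simp add: UNIV_bool edge_weight_def flip: distrib_right add_divide_distrib) (simp add: add_divide_distrib ring_distribs)
  finally show ?thesis .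
qed

lemma sum_neighbors_swap:
  fixes f :: "'a \<Rightarrow> 'a \<Rightarrow> real"
  assumes "finite U" "\<And>v. v \<in> U \<Longrightarrow> A v \<subseteq> U" "\<And>u v. u \<in> U \<Longrightarrow> v \<in> U \<Longrightarrow> u \<in> A v \<longleftrightarrow> v \<in> A u"
  shows "(\<Sum>v\<in>U. \<Sum>u\<in>A v. f u v) = (\<Sum>v\<in>U. \<Sum>u\<in>A v. f v u)"
proof -
  have "finite (A v)" if "v \<in> U" for v using assms(1,2) that finite_subset by blast
  have sym: "u \<in> A v \<Longrightarrow> v \<in> U \<Longrightarrow> u \<in> U \<and> v \<in> A u" for u v
    using assms(2)[of v] assms(3)[of u v] by auto
  have "(\<Sum>v\<in>U. \<Sum>u\<in>A v. f u v) = (\<Sum>(v, u)\<in>Sigma U A. f u v)"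
    using assms(1) \<open>\<And>v. v \<in> U \<Longrightarrow> finite (A v)\<close> by (subst sum.Sigma) auto
  also have "\<dots> = (\<Sum>(v, u)\<in>Sigma U A. f v u)"
    by (rule sum.reindex_bij_witness[of _ prod.swap prod.swap]) (auto dest: sym)
  also have "\<dots> = (\<Sum>v\<in>U. \<Sum>u\<in>A v. f v u)"
    using assms(1) \<open>\<And>v. v \<in> U \<Longrightarrow> finite (A v)\<close> by (subst sum.Sigma) auto
  finally show ?thesis .
qed

text \<open>Entries \<open>None\<close> of \<open>b\<close> are bits that are still random.\<close>

definition mixed_cost ::
  "real \<Rightarrow> ('a \<Rightarrow> bool \<Rightarrow> nat) \<Rightarrow> ('a \<Rightarrow> bool option) \<Rightarrow> 'a set \<Rightarrow> (bool \<Rightarrow> nat) \<Rightarrow> bool \<Rightarrow> real" where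
  "mixed_cost \<delta> s b A r y =
     (\<Sum>u\<in>A. case b u of
        Some x \<Rightarrow> edge_cost (s u) r x y
      | None \<Rightarrow> \<Sum>x\<in>UNIV. bit_prob \<delta> (s u) x * edge_cost (s u) r x y)"

text \<open>
  Sum the optimality of each choice over all nodes. By symmetry, the expected cost between a chosen bit
  and a later random one occurs on both sides and cancels; what remains compares the final cost with
  the expected cost. Edges inside a slot are ignored by the choices and controlled by the defect.
\<close>

lemma sum_cost_of_choice_le:
  fixes U :: "'a set" and slot :: "'a \<Rightarrow> nat"
  assumes U: "finite U" "\<And>v. v \<in> U \<Longrightarrow> A v \<subseteq> U"
      "\<And>u v. u \<in> U \<Longrightarrow> v \<in> U \<Longrightarrow> u \<in> A v \<longleftrightarrow> v \<in> A u"
    and s: "\<And>v. v \<in> U \<Longrightarrow> s v False + s v True > 0"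
    and \<delta>: "0 < \<delta>" "\<delta> \<le> 1 / 3"
    and defect: "\<And>v. v \<in> U \<Longrightarrow>
      (\<Sum>u\<in>{u \<in> A v. slot u = slot v}. edge_weight (s u) (s v)) \<le> \<delta>\<^sup>2 * (\<Sum>u\<in>A v. edge_weight (s u) (s v))"
    and pos: "\<And>v. v \<in> U \<Longrightarrow> bit_prob \<delta> (s v) (b v) > 0"
    and opt: "\<And>v y. v \<in> U \<Longrightarrow> bit_prob \<delta> (s v) y > 0 \<Longrightarrow>
      mixed_cost \<delta> s (\<lambda>u. if slot u < slot v then Some (b u) else None) {u \<in> A v. slot u \<noteq> slot v} (s v) (b v)
      \<le> mixed_cost \<delta> s (\<lambda>u. if slot u < slot v then Some (b u) else None) {u \<in> A v. slot u \<noteq> slot v} (s v) y"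
  shows "(\<Sum>v\<in>U. \<Sum>u\<in>A v. edge_cost (s u) (s v) (b u) (b v))
    \<le> (1 + 3 * \<delta>) * (\<Sum>v\<in>U. \<Sum>u\<in>A v. edge_weight (s u) (s v))"
proof -
  let ?w = "\<lambda>u v. edge_weight (s u) (s v)"
  let ?q = "\<lambda>v. bit_prob \<delta> (s v)"
  let ?W = "\<Sum>v\<in>U. \<Sum>u\<in>A v. ?w u v"
  let ?cc = "\<lambda>u v. edge_cost (s u) (s v) (b u) (b v)"
  let ?eu = "\<lambda>u v y. \<Sum>x\<in>UNIV. ?q u x * edge_cost (s u) (s v) x y"
  let ?ev = "\<lambda>u v. \<Sum>y\<in>UNIV. ?q v y * edge_cost (s u) (s v) (b u) y"
  let ?ee = "\<lambda>u v. \<Sum>y\<in>UNIV. ?q v y * ?eu u v y"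
  let ?S = "\<lambda>P f. \<Sum>v\<in>U. \<Sum>u\<in>A v. if P (slot u) (slot v) then f u v else (0::real)"
  have fA: "finite (A v)" if "v \<in> U" for v using U(1,2) that finite_subset by blast
  have q: "?q v y \<ge> 0" "?q v False + ?q v True = 1" if "v \<in> U" for v y
    by (fact bit_prob_nonneg[OF \<delta> s[OF that]] bit_prob_sum[OF \<delta> s[OF that]])+
  note swap = sum_neighbors_swap[OF U]
  have swapS: "?S (<) f = ?S (>) (\<lambda>u v. f v u)" for f
    by (subst swap) auto
  let ?b = "\<lambda>v u. if slot u < slot v then Some (b u) else None"
  have mixed: "mixed_cost \<delta> s (?b v) {u \<in> A v. slot u \<noteq> slot v} (s v) y =
     (\<Sum>u\<in>A v. if slot u < slot v then edge_cost (s u) (s v) (b u) y else 0)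
     + (\<Sum>u\<in>A v. if slot u > slot v then ?eu u v y else 0)" if "v \<in> U" for v y
    unfolding mixed_cost_def sum.distrib[symmetric] using fA[OF that]
    by (intro sum.mono_neutral_cong_left) auto
  \<comment> \<open>A minimum is at most the mean. Bits of probability 0, on which
    \<open>opt\<close> is silent, drop out of the mean.\<close>
  have ineq: "mixed_cost \<delta> s (?b v) {u \<in> A v. slot u \<noteq> slot v} (s v) (b v)
    \<le> (\<Sum>y\<in>UNIV. ?q v y * mixed_cost \<delta> s (?b v) {u \<in> A v. slot u \<noteq> slot v} (s v) y)" (is "?m (b v) \<le> _") if "v \<in> U" for v
  proof -
    have "?m (b v) = (\<Sum>y\<in>UNIV. ?q v y * ?m (b v))"
      using q(2)[OF that] by (simp add: UNIV_bool flip: distrib_right)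
    also have "\<dots> \<le> (\<Sum>y\<in>UNIV. ?q v y * ?m y)"
    proof (intro sum_mono)
      fix y show "?q v y * ?m (b v) \<le> ?q v y * ?m y"
        using opt[OF that, of y] q(1)[OF that, of y] by (cases "?q v y = 0") (auto intro!: mult_left_mono)
    qed
    finally show ?thesis .
  qed
  have push: "(\<Sum>y\<in>UNIV. ?q v y * (\<Sum>u\<in>A v. if P u then g u y else 0)) =
      (\<Sum>u\<in>A v. if P u then (\<Sum>y\<in>UNIV. ?q v y * g u y) else 0)" for v P g
    unfolding sum_distrib_left by (subst sum.swap) (intro sum.cong, auto)
  have "?S (<) ?cc + ?S (>) (\<lambda>u v. ?eu u v (b v)) \<le> ?S (<) ?ev + ?S (>) ?ee"
    unfolding sum.distrib[symmetric]
  proof (rule sum_mono, goal_cases)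
    case (1 v)
    from ineq[OF 1] show ?case
      unfolding mixed[OF 1] distrib_left sum.distrib[of _ _ UNIV] push
      by (simp add: sum.distrib)
  qed
  moreover have "?ev u v = ?eu v u (b u)" for u v
    by (simp add: edge_cost_commute[of "s u" "s v"])
  then have "?S (<) ?ev = ?S (>) (\<lambda>u v. ?eu u v (b v))"
    by (subst swapS) (simp cong: if_cong)
  ultimately have half: "?S (<) ?cc \<le> ?S (>) ?ee" by simp
  have "?cc u v = ?cc v u" for u v by (rule edge_cost_commute)
  then have "?S (>) ?cc = ?S (<) ?cc" by (subst swapS) (simp cong: if_cong)
  have ee_comm: "?ee u v = ?ee v u" for u v
    by (simp add: UNIV_bool edge_cost_def algebra_simps)
  have ee_nonneg: "?ee u v \<ge> 0" if "u \<in> U" "v \<in> U" for u v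
    using q that by (intro sum_nonneg mult_nonneg_nonneg edge_cost_nonneg) auto
  have "?S (<) ?ee = ?S (>) ?ee" by (subst swapS) (simp only: ee_comm)
  have "?S (\<noteq>) ?cc = ?S (<) ?cc + ?S (>) ?cc"
    unfolding sum.distrib[symmetric] by (intro sum.cong) auto
  also have "\<dots> \<le> ?S (<) ?ee + ?S (>) ?ee"
    using half \<open>?S (>) ?cc = ?S (<) ?cc\<close> \<open>?S (<) ?ee = ?S (>) ?ee\<close> by simp
  also have "\<dots> \<le> (\<Sum>v\<in>U. \<Sum>u\<in>A v. (1 + 2 * \<delta>) * ?w u v)"
    unfolding sum.distrib[symmetric]
  proof (intro sum_mono, goal_cases)
    case (1 v u)
    then have u: "u \<in> U" using U(2) by auto
    have "(if slot u < slot v then ?ee u v else 0) + (if slot v < slot u then ?ee u v else 0) \<le> ?ee u v"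
      using ee_nonneg[OF u 1(1)] by auto
    also have "\<dots> = (\<Sum>x\<in>UNIV. \<Sum>y\<in>UNIV. ?q u x * ?q v y * edge_cost (s u) (s v) x y)"
      by (simp add: UNIV_bool algebra_simps)
    also have "\<dots> \<le> (1 + 2 * \<delta>) * ?w u v"
      by (rule expected_edge_cost_le[OF \<delta> s[OF u] s[OF 1(1)]])
    finally show ?case .
  qed
  finally have diff: "?S (\<noteq>) ?cc \<le> (1 + 2 * \<delta>) * ?W" by (simp add: sum_distrib_left)
  \<comment> \<open>Inside a slot the endpoints ignore each other, so only clipping helps: a cost
    exceeds the weight by at most a factor \<open>1 / \<delta>\<close>. The defect
    \<open>\<delta>\<^sup>2\<close> then leaves a share \<open>\<delta>\<close> of the total
    weight.\<close>
  have cc: "?cc u v \<le> ?w u v / \<delta>" if "u \<in> U" "v \<in> U" for u v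
  proof -
    have *: "1 / real (s v (b v)) \<le> 1 / real (s v False + s v True) / \<delta>" if "v \<in> U" for v
    proof -
      have "\<delta> * real (s v False + s v True) \<le> real (s v (b v))"
        by (rule size_ge_if_bit_prob_pos[OF \<delta> s[OF that] pos[OF that]])
      moreover have "0 < \<delta> * real (s v False + s v True)" using \<delta> s[OF that] by (simp del: of_nat_add)
      ultimately have "1 / real (s v (b v)) \<le> 1 / (\<delta> * real (s v False + s v True))"
        by (intro frac_le) auto
      then show ?thesis by (simp add: mult.commute)
    qed
    show ?thesis
      using *[OF that(1)] *[OF that(2)] edge_weight_nonneg[of "s u" "s v"] \<delta>
      by (auto simp: edge_cost_def edge_weight_def add_divide_distrib)
  qed
  have "?S (=) ?cc \<le> (\<Sum>v\<in>U. \<Sum>u\<in>{u \<in> A v. slot u = slot v}. ?w u v / \<delta>)"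
  proof (rule sum_mono, goal_cases)
    case (1 v)
    have "(\<Sum>u\<in>A v. if slot u = slot v then ?cc u v else 0) = (\<Sum>u\<in>{u \<in> A v. slot u = slot v}. ?cc u v)"
      using fA[OF 1] by (subst sum.inter_filter) auto
    also have "\<dots> \<le> (\<Sum>u\<in>{u \<in> A v. slot u = slot v}. ?w u v / \<delta>)"
      using U(2)[OF 1] by (intro sum_mono cc 1) auto
    finally show ?case .
  qed
  also have "\<dots> \<le> (\<Sum>v\<in>U. \<delta> * (\<Sum>u\<in>A v. ?w u v))"
  proof (rule sum_mono, goal_cases)
    case (1 v)
    then show ?case using defect[OF 1] \<delta> 
      by (simp add: sum_divide_distrib[symmetric] field_simps power2_eq_square)
  qed
  finally have same: "?S (=) ?cc \<le> \<delta> * ?W" by (simp add: sum_distrib_left)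
  have "(\<Sum>v\<in>U. \<Sum>u\<in>A v. ?cc u v) = ?S (\<noteq>) ?cc + ?S (=) ?cc"
    unfolding sum.distrib[symmetric] by (intro sum.cong) auto
  also have "\<dots> \<le> (1 + 2 * \<delta>) * ?W + \<delta> * ?W" using diff same by simp
  also have "\<dots> = (1 + 3 * \<delta>) * ?W" by (simp add: algebra_simps)
  finally show ?thesis .
qed

section \<open>Synchronous broadcast algorithms\<close>

lemma neighbors_subset_nodes: "well_formed I \<Longrightarrow> neighbors I v \<subseteq> nodes I"
  by (fastforce simp: well_formed_def neighbors_def doubleton_eq_iff)

lemma neighbors_sym: "u \<in> neighbors I v \<longleftrightarrow> v \<in> neighbors I u"
  by (simp add: neighbors_def insert_commute)

lemma not_neighbor_self: "well_formed I \<Longrightarrow> v \<notin> neighbors I v"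
  by (force simp: well_formed_def neighbors_def doubleton_eq_iff)

type_synonym 'p rule = "local_input \<Rightarrow> 'p \<Rightarrow> (nat \<Rightarrow> 'p) \<Rightarrow> 'p"

text \<open>One round in which every node broadcasts its whole state. Masking all other nodes by
  \<open>undefined\<close> enforces locality, so a rule needs no side condition.\<close>

definition apply_rule :: "coloring_instance \<Rightarrow> 'p rule \<Rightarrow> (nat \<Rightarrow> 'p) \<Rightarrow> nat \<Rightarrow> 'p" where
  "apply_rule I f \<sigma> v =
     f (local_input_of I v) (\<sigma> v) (\<lambda>u. if u \<in> neighbors I v then \<sigma> u else undefined)"

definition run :: "coloring_instance \<Rightarrow> 'p rule list \<Rightarrow> (nat \<Rightarrow> 'p) \<Rightarrow> nat \<Rightarrow> 'p" where
  "run I fs = fold (apply_rule I) fs"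

lemma run_Nil [simp]: "run I [] \<sigma> = \<sigma>"
  and run_Cons [simp]: "run I (f # fs) \<sigma> = run I fs (apply_rule I f \<sigma>)"
  and run_append [simp]: "run I (fs @ gs) \<sigma> = run I gs (run I fs \<sigma>)"
  by (simp_all add: run_def)

text \<open>A node of a \<open>congest_algorithm\<close> has no memory besides its history, so its
  state is recomputed from the decoded messages. Since \<open>zip\<close> stops at the end of the
  history, only the rules of completed rounds are applied.\<close>

definition replay ::
  "(nat \<Rightarrow> 'p rule list) \<Rightarrow> 'p \<Rightarrow> (nat \<Rightarrow> message \<Rightarrow> 'p) \<Rightarrow> local_input \<Rightarrow> history \<Rightarrow> 'p" where
  "replay prog x0 dec inp h =
     foldl (\<lambda>x (f, m). f inp x
         (\<lambda>u. case m u of Some b \<Rightarrow> dec (in_num_nodes inp) b | None \<Rightarrow> undefined))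
       x0 (zip (prog (in_num_nodes inp)) h)"

definition broadcast_algorithm ::
  "(nat \<Rightarrow> 'p rule list) \<Rightarrow> 'p \<Rightarrow> (nat \<Rightarrow> 'p set) \<Rightarrow> (nat \<Rightarrow> 'p \<Rightarrow> message) \<Rightarrow> ('p \<Rightarrow> nat) \<Rightarrow> congest_algorithm" where
  "broadcast_algorithm prog x0 S enc out =
     (let st = replay prog x0 (\<lambda>n. inv_into (S n) (enc n)) in
      \<lparr>send = (\<lambda>inp h u. enc (in_num_nodes inp) (st inp h)), output_color = (\<lambda>inp h. out (st inp h))\<rparr>)"

lemma length_history_after [simp]: "length (history_after A I t v) = t"
  by (induction t) auto

text \<open>Induction on the rounds shows that the replayed state is the state of the run: all
  states that occur lie in \<open>S n\<close>, where \<open>enc n\<close> is injective, so each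
  message determines the sender's state.\<close>

lemma broadcast_algorithm_correct:
  fixes prog :: "nat \<Rightarrow> 'p rule list" and out :: "'p \<Rightarrow> nat"
  assumes wf: "well_formed I" and n: "n = card (nodes I)" and T: "T = length (prog n)"
    and S: "\<And>t v. t \<le> T \<Longrightarrow> v \<in> nodes I \<Longrightarrow> run I (take t (prog n)) (\<lambda>_. x0) v \<in> S n"
    and inj: "inj_on (enc n) (S n)" and len: "\<And>x. x \<in> S n \<Longrightarrow> length (enc n x) \<le> B"
  defines "A \<equiv> broadcast_algorithm prog x0 S enc out"
  shows "respects_bandwidth A I T B"
    and "\<And>v. v \<in> nodes I \<Longrightarrow> output_after A I T v = out (run I (prog n) (\<lambda>_. x0) v)"
proof -
  let ?st = "replay prog x0 (\<lambda>n. inv_into (S n) (enc n))"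
  have A: "send A inp h u = enc (in_num_nodes inp) (?st inp h)" "output_color A inp h = out (?st inp h)"
    for inp h u
    by (simp_all add: A_def broadcast_algorithm_def Let_def)
  have num: "in_num_nodes (local_input_of I v) = n" for v
    by (simp add: local_input_of_def n)
  have st: "?st (local_input_of I v) (history_after A I t v) = run I (take t (prog n)) (\<lambda>_. x0) v"
    if "t \<le> T" "v \<in> nodes I" for t v
    using that
  proof (induction t arbitrary: v)
    case 0
    then show ?case by (simp add: replay_def)
  next
    case (Suc t)
    let ?r = "run I (take t (prog n)) (\<lambda>_. x0)"
    have t: "t < length (prog n)" using Suc.prems T by simp
    have "zip (take t (prog n)) (history_after A I t v) = zip (prog n) (history_after A I t v)"
      by (rule nth_equalityI) simp_all
    then have split: "zip (prog n) (history_after A I t v @ [m]) = zip (prog n) (history_after A I t v) @ [(prog n ! t, m)]" for m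
      using t by (subst zip_append2) (simp add: Cons_nth_drop_Suc[symmetric])
    have dec: "inv_into (S n) (enc n) (send A (local_input_of I u) (history_after A I t u) v) = ?r u"
      if "u \<in> neighbors I v" for u
    proof -
      have u: "u \<in> nodes I" using neighbors_subset_nodes[OF wf] that by auto
      have "send A (local_input_of I u) (history_after A I t u) v = enc n (?r u)"
        using Suc.IH[OF _ u] Suc.prems by (simp add: A num)
      then show ?thesis using inj S[OF _ u, of t] Suc.prems by simp
    qed
    \<comment> \<open>Outside the neighborhood both sides are \<open>undefined\<close>, the default
      value of \<open>apply_rule\<close>.\<close>
    have nb: "(\<lambda>u. case if u \<in> neighbors I v
            then Some (send A (local_input_of I u) (history_after A I t u) v)
            else None of Some b \<Rightarrow> inv_into (S n) (enc n) b | None \<Rightarrow> undefined)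
        = (\<lambda>u. if u \<in> neighbors I v then ?r u else undefined)"
      using dec by auto
    have "?st (local_input_of I v) (history_after A I (Suc t) v) =
        (prog n ! t) (local_input_of I v) (?st (local_input_of I v) (history_after A I t v))
          (\<lambda>u. if u \<in> neighbors I v then ?r u else undefined)"
      unfolding replay_def num history_after.simps split
      by (simp only: foldl_append foldl.simps prod.case nb)
    also have "?st (local_input_of I v) (history_after A I t v) = ?r v"
      using Suc by simp
    finally show ?case
      using t by (simp add: take_Suc_conv_app_nth apply_rule_def)
  qed
  show "respects_bandwidth A I T B"
    unfolding respects_bandwidth_def
  proof (intro allI impI ballI)
    fix t v u assume "t < T" "v \<in> nodes I" "u \<in> neighbors I v"
    then show "length (send A (local_input_of I v) (history_after A I t v) u) \<le> B"
      using st[of t v] S[of t v] len by (simp add: A num)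
  qed
  show "output_after A I T v = out (run I (prog n) (\<lambda>_. x0) v)" if "v \<in> nodes I" for v
    using st[OF le_refl that] by (simp add: output_after_def A T)
qed

section \<open>The coloring algorithm\<close>

text \<open>
  In level \<open>j\<close> of a phase, \<open>stem\<close> is the prefix \<open>c div 2 ^ Suc j\<close> of the future candidate \<open>c\<close>, and the two
  counts are the numbers of available colors that extend it by the bit 0 and 1.
\<close>

record node_state =
  final_color :: "nat option"
  stem :: nat
  low_count :: nat
  high_count :: nat
  time_slot :: nat
  next_bit :: "bool option"

definition counts :: "node_state \<Rightarrow> bool \<Rightarrow> nat" where
  "counts x b = (if b then high_count x else low_count x)"

definition available :: "local_input \<Rightarrow> (nat \<Rightarrow> node_state) \<Rightarrow> nat set" where
  "available inp nb = in_palette inp - {c. \<exists>u\<in>in_neighbor_ids inp. final_color (nb u) = Some c}"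

definition rivals :: "local_input \<Rightarrow> node_state \<Rightarrow> (nat \<Rightarrow> node_state) \<Rightarrow> nat set" where
  "rivals inp x nb = {u \<in> in_neighbor_ids inp. final_color (nb u) = None \<and> stem (nb u) = stem x}"

text \<open>Chosen such that the loss \<open>1 + 3 * clip L = 1 + 1 / (4 * L)\<close> per bit
  accumulates over \<open>L\<close> bits to at most \<open>exp (1 / 4) \<le> 3 / 2\<close>.\<close>

definition clip :: "nat \<Rightarrow> real" where "clip L = 1 / (12 * real L)"

text \<open>A bit of probability 0 must be avoided even if it is cheaper, as it may leave too few
  candidates.\<close>

definition choose_bit ::
  "real \<Rightarrow> ('a \<Rightarrow> bool \<Rightarrow> nat) \<Rightarrow> ('a \<Rightarrow> bool option) \<Rightarrow> 'a set \<Rightarrow> (bool \<Rightarrow> nat) \<Rightarrow> bool" where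
  "choose_bit \<delta> s b A r \<longleftrightarrow>
     bit_prob \<delta> r True > 0 \<and>
     (bit_prob \<delta> r False = 0 \<or> mixed_cost \<delta> s b A r True \<le> mixed_cost \<delta> s b A r False)"

definition start_rule :: "node_state rule" where
  "start_rule inp x nb = x\<lparr>stem := 0, next_bit := None\<rparr>"

definition count_rule :: "nat \<Rightarrow> node_state rule" where
  "count_rule j inp x nb =
     (let part = \<lambda>b. card {c \<in> available inp nb. c div 2 ^ j = 2 * stem x + of_bool b}
      in x\<lparr>low_count := part False, high_count := part True\<rparr>)"

text \<open>The slot encodes a pair of a position and the letter there. Hence two nodes share a slot
  only if they picked the same position and their codewords agree at it.\<close>

definition slot_rule :: "nat \<Rightarrow> (nat \<Rightarrow> nat \<Rightarrow> nat) \<Rightarrow> node_state rule" where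
  "slot_rule L code inp x nb =
     (let i = arg_min_on (\<lambda>i. \<Sum>u\<in>{u \<in> rivals inp x nb. code u i = code (in_id inp) i}.
            edge_weight (counts (nb u)) (counts x)) {..<word_length L}
      in x\<lparr>time_slot := i * alphabet_size L + code (in_id inp) i\<rparr>)"

text \<open>Rivals of earlier slots show their bits and those of later slots still show
  \<open>None\<close>, which is the partial assignment needed for the conditional
  expectation.\<close>

definition decide_rule :: "nat \<Rightarrow> nat \<Rightarrow> node_state rule" where
  "decide_rule L \<tau> inp x nb =
     (if time_slot x = \<tau>
      then x\<lparr>next_bit := Some (choose_bit (clip L) (\<lambda>u. counts (nb u)) (\<lambda>u. next_bit (nb u))
             {u \<in> rivals inp x nb. time_slot (nb u) \<noteq> time_slot x} (counts x))\<rparr>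
      else x)"

text \<open>The \<open>mod\<close> keeps the stem bounded at every node, decided ones included. At
  an undecided node it does not alter the prefix, which is extended by an available color below
  \<open>2 ^ L\<close>.\<close>

definition commit_rule :: "nat \<Rightarrow> node_state rule" where
  "commit_rule L inp x nb =
     x\<lparr>stem := (2 * stem x + of_bool (next_bit x = Some True)) mod 2 ^ L, next_bit := None\<rparr>"

definition resolve_rule :: "node_state rule" where
  "resolve_rule inp x nb =
     (if final_color x = None \<and> \<not> (\<exists>u\<in>rivals inp x nb. in_id inp < u)
      then x\<lparr>final_color := Some (stem x)\<rparr> else x)"

definition num_slots :: "nat \<Rightarrow> nat" where
  "num_slots L = word_length L * alphabet_size L"

definition level :: "nat \<Rightarrow> (nat \<Rightarrow> nat \<Rightarrow> nat) \<Rightarrow> nat \<Rightarrow> node_state rule list" where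
  "level L code j =
     [count_rule j, slot_rule L code] @ map (decide_rule L) [0..<num_slots L] @ [commit_rule L]"

text \<open>The levels count down, so that the most significant bit is fixed first and level 0
  completes the color.\<close>

primrec levels :: "nat \<Rightarrow> (nat \<Rightarrow> nat \<Rightarrow> nat) \<Rightarrow> nat \<Rightarrow> node_state rule list" where
  "levels L code 0 = []"
| "levels L code (Suc j) = level L code j @ levels L code j"

definition phase :: "nat \<Rightarrow> (nat \<Rightarrow> nat \<Rightarrow> nat) \<Rightarrow> node_state rule list" where
  "phase L code = start_rule # levels L code L @ [resolve_rule]"

definition initial_state :: node_state where
  "initial_state = \<lparr>final_color = None, stem = 0, low_count = 0, high_count = 0, time_slot = 0, next_bit = None\<rparr>"

lemma mixed_cost_cong:
  assumes "\<And>u. u \<in> A \<Longrightarrow> s u = s' u" "\<And>u. u \<in> A \<Longrightarrow> b u = b' u"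
  shows "mixed_cost \<delta> s b A r = mixed_cost \<delta> s' b' A r"
  unfolding mixed_cost_def using assms by (intro ext sum.cong) (auto split: option.split)

lemma choose_bit_cong:
  assumes "\<And>u. u \<in> A \<Longrightarrow> s u = s' u" "\<And>u. u \<in> A \<Longrightarrow> b u = b' u"
  shows "choose_bit \<delta> s b A r = choose_bit \<delta> s' b' A r"
  unfolding choose_bit_def using mixed_cost_cong[of A s s' b b' \<delta> r, OF assms] by simp

lemma choose_bit_optimal:
  assumes "0 < \<delta>" "\<delta> \<le> 1 / 3" "r False + r True > 0"
  shows "bit_prob \<delta> r (choose_bit \<delta> s b A r) > 0"
    and "bit_prob \<delta> r y > 0 \<Longrightarrow> mixed_cost \<delta> s b A r (choose_bit \<delta> s b A r) \<le> mixed_cost \<delta> s b A r y"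
proof -
  note p = bit_prob_sum[OF assms] bit_prob_nonneg[OF assms, of False] bit_prob_nonneg[OF assms, of True]
  show "bit_prob \<delta> r (choose_bit \<delta> s b A r) > 0"
  proof (cases "choose_bit \<delta> s b A r")
    case True
    then show ?thesis by (simp add: choose_bit_def)
  next
    case False
    then have "bit_prob \<delta> r False \<noteq> 0" using p(1) by (auto simp: choose_bit_def)
    then show ?thesis using False p(2) by simp
  qed
  show "mixed_cost \<delta> s b A r (choose_bit \<delta> s b A r) \<le> mixed_cost \<delta> s b A r y"
    if "bit_prob \<delta> r y > 0"
    using that by (cases "choose_bit \<delta> s b A r"; cases y) (simp_all, auto simp: choose_bit_def)
qed

section \<open>The network and its invariants\<close>

locale coloring_network =
  fixes I :: coloring_instance and L :: nat and code :: "nat \<Rightarrow> nat \<Rightarrow> nat"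
  assumes wf: "well_formed I"
    and L: "L > 0"
    and nodes_less: "nodes I \<subseteq> {..<2 ^ L}"
    and colors_le: "num_colors I \<le> 2 ^ L"
    and code: "separating_code L code"
begin

definition undecided :: "(nat \<Rightarrow> node_state) \<Rightarrow> nat set" where
  "undecided \<sigma> = {v \<in> nodes I. final_color (\<sigma> v) = None}"

definition remaining :: "(nat \<Rightarrow> node_state) \<Rightarrow> nat \<Rightarrow> nat set" where
  "remaining \<sigma> v = palette I v - {c. \<exists>u\<in>neighbors I v. final_color (\<sigma> u) = Some c}"

definition conflicts :: "(nat \<Rightarrow> node_state) \<Rightarrow> nat \<Rightarrow> nat set" where
  "conflicts \<sigma> v = {u \<in> neighbors I v. final_color (\<sigma> u) = None \<and> stem (\<sigma> u) = stem (\<sigma> v)}"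

definition candidates :: "(nat \<Rightarrow> node_state) \<Rightarrow> nat \<Rightarrow> nat \<Rightarrow> nat set" where
  "candidates \<sigma> j v = {c \<in> remaining \<sigma> v. c div 2 ^ j = stem (\<sigma> v)}"

text \<open>The sum is over ordered pairs, so every edge counts twice. At level 0, when undecided
  nodes have a single candidate each, every ordered pair contributes 2.\<close>

definition energy :: "(nat \<Rightarrow> node_state) \<Rightarrow> nat \<Rightarrow> real" where
  "energy \<sigma> j = (\<Sum>v\<in>undecided \<sigma>. \<Sum>u\<in>conflicts \<sigma> v.
     1 / real (card (candidates \<sigma> j u)) + 1 / real (card (candidates \<sigma> j v)))"

definition level_ready :: "(nat \<Rightarrow> node_state) \<Rightarrow> nat \<Rightarrow> bool" where
  "level_ready \<sigma> j \<longleftrightarrow> (\<forall>v\<in>undecided \<sigma>. next_bit (\<sigma> v) = None \<and> candidates \<sigma> j v \<noteq> {})"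

text \<open>The second conjunct is the degree-plus-one condition for the residual problem on the
  undecided nodes; it bounds the energy at the start of the next phase.\<close>

definition consistent :: "(nat \<Rightarrow> node_state) \<Rightarrow> bool" where
  "consistent \<sigma> \<longleftrightarrow>
     (\<forall>v\<in>nodes I. \<forall>c. final_color (\<sigma> v) = Some c \<longrightarrow>
        c \<in> palette I v \<and> (\<forall>u\<in>neighbors I v. final_color (\<sigma> u) \<noteq> Some c)) \<and>
     (\<forall>v\<in>undecided \<sigma>. card (neighbors I v \<inter> undecided \<sigma>) < card (remaining \<sigma> v))"

lemma finite_nodes: "finite (nodes I)"
  using wf by (simp add: well_formed_def)

lemma neighbors_subset: "neighbors I v \<subseteq> nodes I"
  using neighbors_subset_nodes[OF wf] .

lemma finite_neighbors: "finite (neighbors I v)"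
  using finite_nodes neighbors_subset finite_subset by blast

lemma finite_undecided: "finite (undecided \<sigma>)"
  using finite_nodes by (simp add: undecided_def)

lemma palette_less: "v \<in> nodes I \<Longrightarrow> palette I v \<subseteq> {..<2 ^ L}"
  using wf colors_le by (force simp: well_formed_def)

lemma remaining_less: "v \<in> nodes I \<Longrightarrow> remaining \<sigma> v \<subseteq> {..<2 ^ L}"
  using palette_less by (force simp: remaining_def)

lemma finite_remaining: "v \<in> nodes I \<Longrightarrow> finite (remaining \<sigma> v)"
  using remaining_less finite_subset by blast

lemma undecided_subset: "undecided \<sigma> \<subseteq> nodes I"
  by (auto simp: undecided_def)

lemma conflicts_subset: "conflicts \<sigma> v \<subseteq> undecided \<sigma>"
  using neighbors_subset by (auto simp: conflicts_def undecided_def)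

lemma finite_conflicts: "finite (conflicts \<sigma> v)"
  using finite_neighbors by (simp add: conflicts_def)

lemma conflicts_sym: "v \<in> undecided \<sigma> \<Longrightarrow> u \<in> undecided \<sigma> \<Longrightarrow> u \<in> conflicts \<sigma> v \<longleftrightarrow> v \<in> conflicts \<sigma> u"
  by (auto simp: conflicts_def undecided_def neighbors_sym)

section \<open>Effect of the rules on the global state\<close>

lemma local_input_of_sel [simp]:
  "in_id (local_input_of I v) = v"
  "in_neighbor_ids (local_input_of I v) = neighbors I v"
  "in_palette (local_input_of I v) = palette I v"
  by (simp_all add: local_input_of_def)

abbreviation (input) "visible \<sigma> v \<equiv> (\<lambda>u. if u \<in> neighbors I v then \<sigma> u else undefined)"

lemma available_eq: "available (local_input_of I v) (visible \<sigma> v) = remaining \<sigma> v"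
  by (auto simp: available_def remaining_def)

lemma rivals_eq: "rivals (local_input_of I v) (\<sigma> v) (visible \<sigma> v) = conflicts \<sigma> v"
  by (auto simp: rivals_def conflicts_def)

lemma apply_start: "apply_rule I start_rule \<sigma> v = (\<sigma> v)\<lparr>stem := 0, next_bit := None\<rparr>"
  by (simp add: apply_rule_def start_rule_def)

lemma apply_count: "apply_rule I (count_rule j) \<sigma> v = (\<sigma> v)
    \<lparr>low_count := card {c \<in> remaining \<sigma> v. c div 2 ^ j = 2 * stem (\<sigma> v)},
     high_count := card {c \<in> remaining \<sigma> v. c div 2 ^ j = 2 * stem (\<sigma> v) + 1}\<rparr>"
  by (simp add: apply_rule_def count_rule_def available_eq)

lemma apply_slot: "apply_rule I (slot_rule L code) \<sigma> v = (\<sigma> v)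
    \<lparr>time_slot := (let i = arg_min_on (\<lambda>i. \<Sum>u\<in>{u \<in> conflicts \<sigma> v. code u i = code v i}.
            edge_weight (counts (\<sigma> u)) (counts (\<sigma> v))) {..<word_length L}
      in i * alphabet_size L + code v i)\<rparr>"
proof -
  have "(\<Sum>u\<in>{u \<in> conflicts \<sigma> v. code u i = code v i}. edge_weight (counts (visible \<sigma> v u)) (counts (\<sigma> v)))
      = (\<Sum>u\<in>{u \<in> conflicts \<sigma> v. code u i = code v i}. edge_weight (counts (\<sigma> u)) (counts (\<sigma> v)))" for i
    by (intro sum.cong) (auto simp: conflicts_def)
  then show ?thesis
    unfolding apply_rule_def slot_rule_def rivals_eq local_input_of_sel Let_def by simp
qed

lemma apply_decide: "apply_rule I (decide_rule L \<tau>) \<sigma> v =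
  (if time_slot (\<sigma> v) = \<tau>
   then (\<sigma> v)\<lparr>next_bit := Some (choose_bit (clip L) (\<lambda>u. counts (\<sigma> u)) (\<lambda>u. next_bit (\<sigma> u))
          {u \<in> conflicts \<sigma> v. time_slot (\<sigma> u) \<noteq> time_slot (\<sigma> v)} (counts (\<sigma> v)))\<rparr>
   else \<sigma> v)"
proof -
  have rivals: "{u \<in> conflicts \<sigma> v. time_slot (visible \<sigma> v u) \<noteq> time_slot (\<sigma> v)} =
      {u \<in> conflicts \<sigma> v. time_slot (\<sigma> u) \<noteq> time_slot (\<sigma> v)}" (is "_ = ?R")
    by (auto simp: conflicts_def)
  have "choose_bit (clip L) (\<lambda>u. counts (visible \<sigma> v u)) (\<lambda>u. next_bit (visible \<sigma> v u)) ?R (counts (\<sigma> v))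
      = choose_bit (clip L) (\<lambda>u. counts (\<sigma> u)) (\<lambda>u. next_bit (\<sigma> u)) ?R (counts (\<sigma> v))"
    by (rule choose_bit_cong) (simp_all add: conflicts_def)
  then show ?thesis
    unfolding apply_rule_def decide_rule_def rivals_eq rivals by (simp only:)
qed

lemma apply_commit: "apply_rule I (commit_rule L) \<sigma> v = (\<sigma> v)
    \<lparr>stem := (2 * stem (\<sigma> v) + of_bool (next_bit (\<sigma> v) = Some True)) mod 2 ^ L, next_bit := None\<rparr>"
  by (simp add: apply_rule_def commit_rule_def)

lemma apply_resolve: "apply_rule I resolve_rule \<sigma> v =
   (if final_color (\<sigma> v) = None \<and> \<not> (\<exists>u\<in>conflicts \<sigma> v. v < u)
    then (\<sigma> v)\<lparr>final_color := Some (stem (\<sigma> v))\<rparr> else \<sigma> v)"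
  unfolding apply_rule_def resolve_rule_def rivals_eq by simp

section \<open>Slots as a defective coloring, and decisions along them\<close>

lemma clip_bounds: "0 < clip L" "clip L \<le> 1 / 3"
  using L by (simp_all add: clip_def field_simps)

lemma arg_min_on_word_length:
  fixes f :: "nat \<Rightarrow> real"
  shows "arg_min_on f {..<word_length L} < word_length L"
    "i < word_length L \<Longrightarrow> f (arg_min_on f {..<word_length L}) \<le> f i"
proof -
  have "word_length L > 0" using L by (simp add: word_length_def alphabet_size_def)
  then have ne: "{..<word_length L} \<noteq> {}" by auto
  show "arg_min_on f {..<word_length L} < word_length L"
    using arg_min_if_finite(1)[OF _ ne, of f] by simp
  show "i < word_length L \<Longrightarrow> f (arg_min_on f {..<word_length L}) \<le> f i"
    using arg_min_least[OF _ ne, of i f] by simp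
qed

lemma code_less: "v \<in> nodes I \<Longrightarrow> i < word_length L \<Longrightarrow> code v i < alphabet_size L"
  using code nodes_less by (auto simp: separating_code_def)

lemma slot_bound:
  assumes "v \<in> nodes I"
  shows "time_slot (apply_rule I (slot_rule L code) \<sigma> v) < num_slots L"
proof -
  define i where "i = arg_min_on (\<lambda>i. \<Sum>u\<in>{u \<in> conflicts \<sigma> v. code u i = code v i}.
            edge_weight (counts (\<sigma> u)) (counts (\<sigma> v))) {..<word_length L}"
  have i: "i < word_length L" unfolding i_def by (rule arg_min_on_word_length)
  have "i * alphabet_size L + code v i < i * alphabet_size L + alphabet_size L"
    using code_less[OF assms i] by simp
  also have "\<dots> = Suc i * alphabet_size L" by simp
  also have "\<dots> \<le> num_slots L" unfolding num_slots_def using i by (intro mult_right_mono) auto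
  finally show ?thesis by (simp add: apply_slot i_def[symmetric] Let_def)
qed

text \<open>Averaging over the positions: two codewords agree in a small fraction of all positions.\<close>

lemma slot_defect:
  assumes v: "v \<in> undecided \<sigma>"
  defines "\<sigma>' \<equiv> apply_rule I (slot_rule L code) \<sigma>"
  defines "w \<equiv> \<lambda>u. edge_weight (counts (\<sigma> u)) (counts (\<sigma> v))"
  shows "(\<Sum>u\<in>{u \<in> conflicts \<sigma> v. time_slot (\<sigma>' u) = time_slot (\<sigma>' v)}. w u)
    \<le> (clip L)\<^sup>2 * (\<Sum>u\<in>conflicts \<sigma> v. w u)"
proof -
  define f where "f = (\<lambda>i. \<Sum>u\<in>{u \<in> conflicts \<sigma> v. code u i = code v i}. w u)"
  define W where "W = (\<Sum>u\<in>conflicts \<sigma> v. w u)"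
  define i where "i = arg_min_on f {..<word_length L}"
  have vn: "v \<in> nodes I" using v by (simp add: undecided_def)
  have w: "w u \<ge> 0" for u by (simp add: w_def edge_weight_nonneg)
  have i: "i < word_length L" unfolding i_def by (rule arg_min_on_word_length)
  have slot_v: "time_slot (\<sigma>' v) = i * alphabet_size L + code v i"
    by (simp add: \<sigma>'_def apply_slot i_def f_def w_def Let_def)
  have agree: "card {k \<in> {..<word_length L}. code u k = code v k} \<le> 4 * L" if "u \<in> conflicts \<sigma> v" for u
  proof -
    have "u \<in> nodes I" using that conflicts_subset undecided_subset by blast
    moreover have "u \<noteq> v" using that not_neighbor_self[OF wf] by (auto simp: conflicts_def)
    moreover have "u < 2 ^ L" "v < 2 ^ L" using \<open>u \<in> nodes I\<close> vn nodes_less by auto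
    ultimately show ?thesis using code unfolding separating_code_def by (blast intro: less_imp_le)
  qed
  have "f i * real (word_length L) = (\<Sum>k<word_length L. f i)" by simp
  also have "\<dots> \<le> (\<Sum>k<word_length L. f k)"
    unfolding i_def by (intro sum_mono arg_min_on_word_length) auto
  also have "\<dots> = (\<Sum>k<word_length L. \<Sum>u\<in>conflicts \<sigma> v. if code u k = code v k then w u else 0)"
    unfolding f_def using finite_conflicts by (simp add: sum.inter_filter)
  also have "\<dots> = (\<Sum>u\<in>conflicts \<sigma> v. \<Sum>k<word_length L. if code u k = code v k then w u else 0)"
    by (rule sum.swap)
  also have "\<dots> = (\<Sum>u\<in>conflicts \<sigma> v. real (card {k \<in> {..<word_length L}. code u k = code v k}) * w u)"
    by (simp flip: sum.inter_filter)
  also have "\<dots> \<le> (\<Sum>u\<in>conflicts \<sigma> v. real (4 * L) * w u)"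
    using agree by (intro sum_mono mult_right_mono w of_nat_mono) auto
  also have "\<dots> = real (4 * L) * W" by (simp add: W_def sum_distrib_left)
  also have "real (4 * L) = (clip L)\<^sup>2 * real (word_length L)"
    using L by (simp add: clip_def word_length_def alphabet_size_def field_simps power2_eq_square)
  finally have "f i * real (word_length L) \<le> ((clip L)\<^sup>2 * W) * real (word_length L)"
    by (simp add: mult_ac)
  then have "f i \<le> (clip L)\<^sup>2 * W" using i by (simp add: mult_le_cancel_right)
  moreover have "(\<Sum>u\<in>{u \<in> conflicts \<sigma> v. time_slot (\<sigma>' u) = time_slot (\<sigma>' v)}. w u) \<le> f i"
    unfolding f_def
  proof (intro sum_mono2)
    show "{u \<in> conflicts \<sigma> v. time_slot (\<sigma>' u) = time_slot (\<sigma>' v)}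
        \<subseteq> {u \<in> conflicts \<sigma> v. code u i = code v i}"
    proof safe
      fix u assume u: "u \<in> conflicts \<sigma> v" and eq: "time_slot (\<sigma>' u) = time_slot (\<sigma>' v)"
      define k where "k = arg_min_on (\<lambda>i. \<Sum>x\<in>{x \<in> conflicts \<sigma> u. code x i = code u i}.
            edge_weight (counts (\<sigma> x)) (counts (\<sigma> u))) {..<word_length L}"
      have k: "k < word_length L" unfolding k_def by (rule arg_min_on_word_length)
      have un: "u \<in> nodes I" using u conflicts_subset undecided_subset by blast
      have "time_slot (\<sigma>' u) = k * alphabet_size L + code u k"
        by (simp add: \<sigma>'_def apply_slot k_def Let_def)
      then have e: "k * alphabet_size L + code u k = i * alphabet_size L + code v i"
        using eq slot_v by simp
      \<comment> \<open>Letters are below \<open>alphabet_size L\<close>, so division recovers the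
        position from the slot.\<close>
      have "(k * alphabet_size L + code u k) div alphabet_size L = k"
        "(i * alphabet_size L + code v i) div alphabet_size L = i"
        using code_less[OF un k] code_less[OF vn i] by auto
      then have "k = i" using e by simp
      then show "code u i = code v i" using e by simp
    qed
  qed (use finite_conflicts w in auto)
  ultimately show ?thesis by (simp add: W_def)
qed

text \<open>Replaces the sequential decisions by one static assignment \<open>b\<close> that
  satisfies the equation of the greedy choice at all nodes that have acted. This is possible because
  a choice reads only bits of smaller slots, which later rounds leave unchanged.\<close>

lemma run_decide:
  assumes bits: "\<forall>v\<in>undecided \<sigma>. next_bit (\<sigma> v) = None"
  shows "\<exists>b. (\<forall>v. run I (map (decide_rule L) [0..<\<tau>]) \<sigma> v =
        (\<sigma> v)\<lparr>next_bit := if time_slot (\<sigma> v) < \<tau> then Some (b v) else next_bit (\<sigma> v)\<rparr>) \<and>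
     (\<forall>v. time_slot (\<sigma> v) < \<tau> \<longrightarrow>
        b v = choose_bit (clip L) (\<lambda>u. counts (\<sigma> u))
          (\<lambda>u. if time_slot (\<sigma> u) < time_slot (\<sigma> v) then Some (b u) else None)
          {u \<in> conflicts \<sigma> v. time_slot (\<sigma> u) \<noteq> time_slot (\<sigma> v)} (counts (\<sigma> v)))"
proof (induction \<tau>)
  case 0
  then show ?case by simp
next
  case (Suc \<tau>)
  let ?choice = "\<lambda>b v. choose_bit (clip L) (\<lambda>u. counts (\<sigma> u))
          (\<lambda>u. if time_slot (\<sigma> u) < time_slot (\<sigma> v) then Some (b u) else None)
          {u \<in> conflicts \<sigma> v. time_slot (\<sigma> u) \<noteq> time_slot (\<sigma> v)} (counts (\<sigma> v))"
  from Suc obtain b where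
    b: "\<And>v. run I (map (decide_rule L) [0..<\<tau>]) \<sigma> v =
        (\<sigma> v)\<lparr>next_bit := if time_slot (\<sigma> v) < \<tau> then Some (b v) else next_bit (\<sigma> v)\<rparr>"
      "\<And>v. time_slot (\<sigma> v) < \<tau> \<Longrightarrow> b v = ?choice b v"
    by auto
  let ?\<sigma> = "run I (map (decide_rule L) [0..<\<tau>]) \<sigma>"
  define b' where "b' = (\<lambda>v. if time_slot (\<sigma> v) = \<tau> then ?choice b v else b v)"
  \<comment> \<open>Such a choice reads only bits of slots below \<open>\<tau>\<close>, where
    \<open>b\<close> and \<open>b'\<close> agree.\<close>
  have same: "?choice b' v = ?choice b v" if "time_slot (\<sigma> v) \<le> \<tau>" for v
    by (rule choose_bit_cong) (use that in \<open>auto simp: b'_def\<close>)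
  have conf: "conflicts ?\<sigma> v = conflicts \<sigma> v" for v
    by (simp add: conflicts_def b(1))
  have decided: "choose_bit (clip L) (\<lambda>u. counts (?\<sigma> u)) (\<lambda>u. next_bit (?\<sigma> u))
      {u \<in> conflicts \<sigma> v. time_slot (?\<sigma> u) \<noteq> time_slot (?\<sigma> v)} (counts (?\<sigma> v)) = ?choice b v"
    if "time_slot (\<sigma> v) = \<tau>" for v
  proof -
    have c: "counts (?\<sigma> u) = counts (\<sigma> u)" for u
      by (auto simp: b(1) counts_def)
    have t: "time_slot (?\<sigma> u) = time_slot (\<sigma> u)" for u
      by (simp add: b(1))
    \<comment> \<open>Rivals are undecided, so by \<open>bits\<close> those that have not acted yet
      still carry \<open>None\<close>.\<close>
    have n: "next_bit (?\<sigma> u) = (if time_slot (\<sigma> u) < time_slot (\<sigma> v) then Some (b u) else None)"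
      if "u \<in> conflicts \<sigma> v" for u
      using that bits conflicts_subset[of \<sigma> v] \<open>time_slot (\<sigma> v) = \<tau>\<close> by (auto simp: b(1))
    show ?thesis unfolding c t by (rule choose_bit_cong) (auto simp: n)
  qed
  have "run I (map (decide_rule L) [0..<Suc \<tau>]) \<sigma> v =
        (\<sigma> v)\<lparr>next_bit := if time_slot (\<sigma> v) < Suc \<tau> then Some (b' v) else next_bit (\<sigma> v)\<rparr>" for v
  proof -
    have "run I (map (decide_rule L) [0..<Suc \<tau>]) \<sigma> v = apply_rule I (decide_rule L \<tau>) ?\<sigma> v" by simp
    also have "\<dots> = (if time_slot (\<sigma> v) = \<tau> then (?\<sigma> v)\<lparr>next_bit := Some (?choice b v)\<rparr> else ?\<sigma> v)"
      unfolding apply_decide conf using decided[of v] by (simp add: b(1)[of v])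
    also have "\<dots> = (\<sigma> v)\<lparr>next_bit := if time_slot (\<sigma> v) < Suc \<tau> then Some (b' v) else next_bit (\<sigma> v)\<rparr>"
      by (auto simp: b(1) b'_def)
    finally show ?thesis .
  qed
  moreover have "b' v = ?choice b' v" if "time_slot (\<sigma> v) < Suc \<tau>" for v
    using same[of v] b(2)[of v] that by (auto simp: b'_def)
  ultimately show ?case by blast
qed

section \<open>The energy over one level and over one phase\<close>

lemma card_candidates_Suc:
  assumes "v \<in> nodes I"
  shows "card (candidates \<sigma> (Suc j) v) =
    card {c \<in> remaining \<sigma> v. c div 2 ^ j = 2 * stem (\<sigma> v)} +
    card {c \<in> remaining \<sigma> v. c div 2 ^ j = 2 * stem (\<sigma> v) + 1}"
proof -
  have "c div 2 ^ Suc j = m \<longleftrightarrow> c div 2 ^ j = 2 * m \<or> c div 2 ^ j = 2 * m + 1" for c m :: nat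
    by (simp only: power_Suc2 div_mult2_eq) auto
  then have "candidates \<sigma> (Suc j) v = {c \<in> remaining \<sigma> v. c div 2 ^ j = 2 * stem (\<sigma> v)} \<union>
      {c \<in> remaining \<sigma> v. c div 2 ^ j = 2 * stem (\<sigma> v) + 1}"
    unfolding candidates_def by blast
  then show ?thesis
    using finite_remaining[OF assms] by (simp, subst card_Un_disjoint) auto
qed

text \<open>An instance of \<open>sum_cost_of_choice_le\<close> on the conflict graph. The two
  counts of a node add up to its number of candidates, so the total \<open>edge_weight\<close> is
  the old energy; the total \<open>edge_cost\<close> of the chosen bits is the new one.\<close>

lemma run_level:
  assumes ready: "level_ready \<sigma> (Suc j)"
  defines "\<sigma>' \<equiv> run I (level L code j) \<sigma>"
  shows "final_color (\<sigma>' v) = final_color (\<sigma> v)"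
    and "level_ready \<sigma>' j"
    and "energy \<sigma>' j \<le> (1 + 3 * clip L) * energy \<sigma> (Suc j)"
proof -
  define \<sigma>1 where "\<sigma>1 = apply_rule I (count_rule j) \<sigma>"
  define \<sigma>2 where "\<sigma>2 = apply_rule I (slot_rule L code) \<sigma>1"
  define \<sigma>3 where "\<sigma>3 = run I (map (decide_rule L) [0..<num_slots L]) \<sigma>2"
  have \<sigma>': "\<sigma>' = apply_rule I (commit_rule L) \<sigma>3"
    by (simp add: \<sigma>'_def level_def \<sigma>1_def \<sigma>2_def \<sigma>3_def)
  define s where "s = (\<lambda>v b. card {c \<in> remaining \<sigma> v. c div 2 ^ j = 2 * stem (\<sigma> v) + of_bool b})"
  have s_sum: "s v False + s v True = card (candidates \<sigma> (Suc j) v)" if "v \<in> nodes I" for v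
    using card_candidates_Suc[OF that] by (simp add: s_def)
  have s1: "counts (\<sigma>1 v) = s v" for v
    by (auto simp: \<sigma>1_def apply_count counts_def s_def)
  have s2: "counts (\<sigma>2 v) = s v" for v
    unfolding s1[symmetric] by (simp add: \<sigma>2_def apply_slot counts_def fun_eq_iff)
  have sel2: "final_color (\<sigma>2 v) = final_color (\<sigma> v)" "stem (\<sigma>2 v) = stem (\<sigma> v)"
      "next_bit (\<sigma>2 v) = next_bit (\<sigma> v)" for v
    by (simp_all add: \<sigma>2_def \<sigma>1_def apply_slot apply_count)
  have und2: "undecided \<sigma>2 = undecided \<sigma>" by (simp add: undecided_def sel2)
  have conf1: "conflicts \<sigma>1 v = conflicts \<sigma> v" for v by (simp add: conflicts_def \<sigma>1_def apply_count)
  have und1: "undecided \<sigma>1 = undecided \<sigma>" by (simp add: undecided_def \<sigma>1_def apply_count)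
  have conf2: "conflicts \<sigma>2 v = conflicts \<sigma> v" for v by (simp add: conflicts_def sel2)
  have "\<forall>v\<in>undecided \<sigma>2. next_bit (\<sigma>2 v) = None"
    using ready by (simp add: und2 sel2 level_ready_def)
  from run_decide[where \<sigma> = \<sigma>2 and \<tau> = "num_slots L", OF this, folded \<sigma>3_def, unfolded s2 conf2] obtain b where
    b3': "\<forall>v. \<sigma>3 v = (\<sigma>2 v)\<lparr>next_bit := if time_slot (\<sigma>2 v) < num_slots L then Some (b v) else next_bit (\<sigma>2 v)\<rparr>"
    and b': "\<forall>v. time_slot (\<sigma>2 v) < num_slots L \<longrightarrow> b v = choose_bit (clip L) s
          (\<lambda>u. if time_slot (\<sigma>2 u) < time_slot (\<sigma>2 v) then Some (b u) else None)
          {u \<in> conflicts \<sigma> v. time_slot (\<sigma>2 u) \<noteq> time_slot (\<sigma>2 v)} (s v)"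
    by (elim exE conjE) (rule that)
  note b3 = b3'[rule_format] and b = b'[rule_format]
  have slot: "time_slot (\<sigma>2 v) < num_slots L" if "v \<in> undecided \<sigma>" for v
    unfolding \<sigma>2_def by (rule slot_bound) (use that in \<open>simp add: undecided_def\<close>)
  have s_pos: "s v False + s v True > 0" if "v \<in> undecided \<sigma>" for v
  proof -
    have "v \<in> nodes I" using that by (simp add: undecided_def)
    moreover have "candidates \<sigma> (Suc j) v \<noteq> {}" using ready that by (simp add: level_ready_def)
    moreover have "finite (candidates \<sigma> (Suc j) v)"
      using finite_remaining[OF \<open>v \<in> nodes I\<close>] by (simp add: candidates_def)
    ultimately show ?thesis using s_sum by (simp add: card_gt_0_iff)
  qed
  have pos: "bit_prob (clip L) (s v) (b v) > 0" if "v \<in> undecided \<sigma>" for v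
    by (subst b[OF slot[OF that]]) (rule choose_bit_optimal(1)[OF clip_bounds s_pos[OF that]])
  have opt: "mixed_cost (clip L) s (\<lambda>u. if time_slot (\<sigma>2 u) < time_slot (\<sigma>2 v) then Some (b u) else None)
       {u \<in> conflicts \<sigma> v. time_slot (\<sigma>2 u) \<noteq> time_slot (\<sigma>2 v)} (s v) (b v)
     \<le> mixed_cost (clip L) s (\<lambda>u. if time_slot (\<sigma>2 u) < time_slot (\<sigma>2 v) then Some (b u) else None)
       {u \<in> conflicts \<sigma> v. time_slot (\<sigma>2 u) \<noteq> time_slot (\<sigma>2 v)} (s v) y"
    if "v \<in> undecided \<sigma>" "bit_prob (clip L) (s v) y > 0" for v y
    by (subst b[OF slot[OF that(1)]]) (rule choose_bit_optimal(2)[OF clip_bounds s_pos[OF that(1)] that(2)])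
  have chosen_pos: "s v (b v) > 0" if "v \<in> undecided \<sigma>" for v
  proof -
    have "0 < clip L * real (s v False + s v True)"
      using clip_bounds s_pos[OF that] by (simp del: of_nat_add)
    also have "\<dots> \<le> real (s v (b v))"
      by (rule size_ge_if_bit_prob_pos[OF clip_bounds s_pos[OF that] pos[OF that]])
    finally show ?thesis by simp
  qed
  show fin: "final_color (\<sigma>' v) = final_color (\<sigma> v)" for v
    by (simp add: \<sigma>' apply_commit b3 sel2)
  have und': "undecided \<sigma>' = undecided \<sigma>" by (simp add: undecided_def fin)
  have rem': "remaining \<sigma>' v = remaining \<sigma> v" for v by (simp add: remaining_def fin)
  have stem': "stem (\<sigma>' v) = 2 * stem (\<sigma> v) + of_bool (b v)" if "v \<in> undecided \<sigma>" for v
  proof -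
    have "{c \<in> remaining \<sigma> v. c div 2 ^ j = 2 * stem (\<sigma> v) + of_bool (b v)} \<noteq> {}"
      using chosen_pos[OF that] unfolding s_def by (metis card.empty less_irrefl)
    then obtain c where c: "c \<in> remaining \<sigma> v" "c div 2 ^ j = 2 * stem (\<sigma> v) + of_bool (b v)" by blast
    have "2 * stem (\<sigma> v) + of_bool (b v) \<le> c" unfolding c(2)[symmetric] by simp
    also have "c < 2 ^ L" using remaining_less[of v \<sigma>] c(1) that by (auto simp: undecided_def)
    finally show ?thesis
      using slot[OF that] by (simp add: \<sigma>' apply_commit b3 sel2)
  qed
  have cand': "card (candidates \<sigma>' j v) = s v (b v)" if "v \<in> undecided \<sigma>" for v
    by (simp add: candidates_def rem' stem'[OF that] s_def)
  have conf': "conflicts \<sigma>' v = {u \<in> conflicts \<sigma> v. b u = b v}" if v: "v \<in> undecided \<sigma>" for v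
  proof -
    have "stem (\<sigma>' u) = stem (\<sigma>' v) \<longleftrightarrow> stem (\<sigma> u) = stem (\<sigma> v) \<and> b u = b v"
      if "u \<in> undecided \<sigma>" for u
      unfolding stem'[OF that] stem'[OF v] by (cases "b u"; cases "b v"; simp; presburger)
    moreover have "u \<in> undecided \<sigma>" if "u \<in> neighbors I v" "final_color (\<sigma> u) = None" for u
      using that neighbors_subset by (auto simp: undecided_def)
    ultimately show ?thesis
      unfolding conflicts_def fin by blast
  qed
  show "level_ready \<sigma>' j"
    unfolding level_ready_def und'
  proof (intro ballI conjI)
    fix v assume v: "v \<in> undecided \<sigma>"
    show "next_bit (\<sigma>' v) = None" by (simp add: \<sigma>' apply_commit)
    show "candidates \<sigma>' j v \<noteq> {}" using cand'[OF v] chosen_pos[OF v] by auto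
  qed
  have "energy \<sigma>' j = (\<Sum>v\<in>undecided \<sigma>. \<Sum>u\<in>conflicts \<sigma> v. edge_cost (s u) (s v) (b u) (b v))"
    unfolding energy_def und'
  proof (rule sum.cong[OF refl], goal_cases)
    case (1 v)
    have "(\<Sum>u\<in>{u \<in> conflicts \<sigma> v. b u = b v}.
          1 / real (card (candidates \<sigma>' j u)) + 1 / real (card (candidates \<sigma>' j v))) =
        (\<Sum>u\<in>{u \<in> conflicts \<sigma> v. b u = b v}. edge_cost (s u) (s v) (b u) (b v))"
      using conflicts_subset[of \<sigma> v] 1 by (intro sum.cong) (auto simp: cand' edge_cost_def)
    also have "\<dots> = (\<Sum>u\<in>conflicts \<sigma> v. edge_cost (s u) (s v) (b u) (b v))"
      using finite_conflicts by (intro sum.mono_neutral_left) (auto simp: edge_cost_def)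
    finally show ?case by (simp add: conf'[OF 1])
  qed
  also have "\<dots> \<le> (1 + 3 * clip L) * (\<Sum>v\<in>undecided \<sigma>. \<Sum>u\<in>conflicts \<sigma> v. edge_weight (s u) (s v))"
  proof (rule sum_cost_of_choice_le[where slot = "\<lambda>v. time_slot (\<sigma>2 v)"], goal_cases)
    case (3 u v)
    then show ?case by (rule conflicts_sym[rotated])
  next
    case (7 v)
    then show ?case using slot_defect[of v \<sigma>1] by (simp add: und1 conf1 s1 \<sigma>2_def)
  next
    case (9 v y)
    then show ?case by (rule opt)
  qed (erule s_pos pos | rule finite_undecided conflicts_subset clip_bounds)+
  also have "(\<Sum>v\<in>undecided \<sigma>. \<Sum>u\<in>conflicts \<sigma> v. edge_weight (s u) (s v)) = energy \<sigma> (Suc j)"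
    unfolding energy_def
  proof (intro sum.cong refl, goal_cases)
    case (1 v u)
    then have "u \<in> nodes I" "v \<in> nodes I"
      using conflicts_subset undecided_subset by blast+
    then show ?case by (simp add: edge_weight_def s_sum del: of_nat_add)
  qed
  finally show "energy \<sigma>' j \<le> (1 + 3 * clip L) * energy \<sigma> (Suc j)" .
qed

lemma run_levels:
  assumes "level_ready \<sigma> j"
  shows "final_color (run I (levels L code j) \<sigma> v) = final_color (\<sigma> v)"
    and "level_ready (run I (levels L code j) \<sigma>) 0"
    and "energy (run I (levels L code j) \<sigma>) 0 \<le> (1 + 3 * clip L) ^ j * energy \<sigma> j"
proof -
  have "(\<forall>v. final_color (run I (levels L code j) \<sigma> v) = final_color (\<sigma> v)) \<and>
      level_ready (run I (levels L code j) \<sigma>) 0 \<and>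
      energy (run I (levels L code j) \<sigma>) 0 \<le> (1 + 3 * clip L) ^ j * energy \<sigma> j"
    using assms
  proof (induction j arbitrary: \<sigma>)
    case (Suc j)
    note step = run_level[OF Suc.prems]
    note IH = Suc.IH[OF step(2)]
    have "energy (run I (levels L code (Suc j)) \<sigma>) 0
        \<le> (1 + 3 * clip L) ^ j * energy (run I (level L code j) \<sigma>) j"
      using IH by simp
    also have "\<dots> \<le> (1 + 3 * clip L) ^ j * ((1 + 3 * clip L) * energy \<sigma> (Suc j))"
      using clip_bounds by (intro mult_left_mono step(3)) auto
    finally show ?case using IH step(1) by (simp add: mult_ac)
  qed simp
  then show "final_color (run I (levels L code j) \<sigma> v) = final_color (\<sigma> v)"
    "level_ready (run I (levels L code j) \<sigma>) 0"
    "energy (run I (levels L code j) \<sigma>) 0 \<le> (1 + 3 * clip L) ^ j * energy \<sigma> j"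
    by blast+
qed

lemma sum_conflicts_swap:
  "(\<Sum>v\<in>undecided \<sigma>. \<Sum>u\<in>conflicts \<sigma> v. f u v) = (\<Sum>v\<in>undecided \<sigma>. \<Sum>u\<in>conflicts \<sigma> v. f v u :: real)"
  by (rule sum_neighbors_swap[OF finite_undecided conflicts_subset conflicts_sym[rotated]])

text \<open>With the empty prefix all remaining colors are candidates and all undecided neighbors
  conflict. By symmetry the energy is twice the sum of the quotients of undecided degree and number
  of remaining colors, each at most 1 by \<open>consistent\<close>.\<close>

lemma run_start:
  assumes "consistent \<sigma>"
  defines "\<sigma>' \<equiv> apply_rule I start_rule \<sigma>"
  shows "final_color (\<sigma>' v) = final_color (\<sigma> v)"
    and "level_ready \<sigma>' L"
    and "energy \<sigma>' L \<le> 2 * real (card (undecided \<sigma>))"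
proof -
  show fin: "final_color (\<sigma>' v) = final_color (\<sigma> v)" for v
    by (simp add: \<sigma>'_def apply_start)
  have und: "undecided \<sigma>' = undecided \<sigma>" by (simp add: undecided_def fin)
  have rem: "remaining \<sigma>' v = remaining \<sigma> v" for v by (simp add: remaining_def fin)
  have cand: "candidates \<sigma>' L v = remaining \<sigma> v" if "v \<in> nodes I" for v
    using remaining_less[OF that, of \<sigma>]
    by (auto simp: candidates_def rem, auto simp: \<sigma>'_def apply_start)
  have card: "card (neighbors I v \<inter> undecided \<sigma>) < card (remaining \<sigma> v)" if "v \<in> undecided \<sigma>" for v
    using assms(1) that by (simp add: consistent_def)
  show "level_ready \<sigma>' L"
    unfolding level_ready_def und
  proof (intro ballI conjI)
    fix v assume v: "v \<in> undecided \<sigma>"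
    show "next_bit (\<sigma>' v) = None" by (simp add: \<sigma>'_def apply_start)
    show "candidates \<sigma>' L v \<noteq> {}"
      using card[OF v] cand[of v] v undecided_subset[of \<sigma>] by auto
  qed
  let ?k = "\<lambda>v. 1 / real (card (remaining \<sigma> v))"
  have conf: "conflicts \<sigma>' v = neighbors I v \<inter> undecided \<sigma>" for v
    using neighbors_subset[of v] by (auto simp: conflicts_def undecided_def \<sigma>'_def apply_start)
  have "energy \<sigma>' L = (\<Sum>v\<in>undecided \<sigma>'. \<Sum>u\<in>conflicts \<sigma>' v. ?k u + ?k v)"
    unfolding energy_def using undecided_subset[of \<sigma>'] conflicts_subset[of \<sigma>']
    by (intro sum.cong) (auto simp: cand subset_iff)
  also have "\<dots> = 2 * (\<Sum>v\<in>undecided \<sigma>'. \<Sum>u\<in>conflicts \<sigma>' v. ?k v)"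
    unfolding sum.distrib using sum_conflicts_swap[of "\<lambda>u v. ?k u" \<sigma>'] by simp
  also have "\<dots> \<le> 2 * (\<Sum>v\<in>undecided \<sigma>. 1)"
    unfolding und conf
  proof (intro mult_left_mono sum_mono, goal_cases)
    case (1 v)
    have "real (card (neighbors I v \<inter> undecided \<sigma>)) \<le> real (card (remaining \<sigma> v))"
      using card[OF 1] by simp
    then show ?case by (simp add: divide_le_eq)
  qed simp
  finally show "energy \<sigma>' L \<le> 2 * real (card (undecided \<sigma>))" by simp
qed

lemma energy_factor: "(1 + 3 * clip L) ^ L \<le> 3 / 2"
proof -
  have "(1 + 3 * clip L) ^ L \<le> exp (3 * clip L) ^ L"
    using clip_bounds exp_ge_add_one_self[of "3 * clip L"] by (intro power_mono) auto
  also have "\<dots> = exp (1 / 4)"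
    using L by (simp add: clip_def field_simps flip: exp_of_nat_mult)
  also have "\<dots> \<le> 1 + 1 / 4 + (1 / 4)\<^sup>2"
    by (rule exp_bound) auto
  also have "\<dots> \<le> 3 / 2" by (simp add: power2_eq_square)
  finally show ?thesis .
qed

text \<open>A neighbor that wins costs a node at most one color but also leaves its undecided
  neighborhood, so the slack persists. For the progress, each loser is charged to a conflict edge of
  which it is the smaller endpoint; there are \<open>energy / 4\<close> such edges, at most
  \<open>3 / 2 * 2 / 4 = 3 / 4\<close> times the number of undecided nodes.\<close>

lemma run_phase:
  assumes good: "consistent \<sigma>"
  defines "\<sigma>' \<equiv> run I (phase L code) \<sigma>"
  shows "consistent \<sigma>'" and "4 * card (undecided \<sigma>') \<le> 3 * card (undecided \<sigma>)"
proof -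
  define \<sigma>1 where "\<sigma>1 = run I (levels L code L) (apply_rule I start_rule \<sigma>)"
  have \<sigma>': "\<sigma>' = apply_rule I resolve_rule \<sigma>1"
    by (simp add: \<sigma>'_def \<sigma>1_def phase_def)
  note start = run_start[OF good]
  have fin1: "final_color (\<sigma>1 v) = final_color (\<sigma> v)" for v
    using run_levels(1)[OF start(2)] start(1) by (simp add: \<sigma>1_def)
  have ready: "level_ready \<sigma>1 0"
    using run_levels(2)[OF start(2)] by (simp add: \<sigma>1_def)
  have und1: "undecided \<sigma>1 = undecided \<sigma>" by (simp add: undecided_def fin1)
  have rem1: "remaining \<sigma>1 v = remaining \<sigma> v" for v by (simp add: remaining_def fin1)
  have cand: "candidates \<sigma>1 0 v = {stem (\<sigma>1 v)}" "stem (\<sigma>1 v) \<in> remaining \<sigma> v"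
    if "v \<in> undecided \<sigma>" for v
    using ready that by (auto simp: level_ready_def candidates_def und1 rem1)
  define win where "win v \<longleftrightarrow> v \<in> undecided \<sigma> \<and> \<not> (\<exists>u\<in>conflicts \<sigma>1 v. v < u)" for v
  have fin': "final_color (\<sigma>' v) = (if win v then Some (stem (\<sigma>1 v)) else final_color (\<sigma> v))"
    if "v \<in> nodes I" for v
    using that by (auto simp: \<sigma>' apply_resolve win_def undecided_def fin1)
  have win_und: "win v \<Longrightarrow> v \<in> undecided \<sigma>" for v by (simp add: win_def)
  have und': "undecided \<sigma>' = {v \<in> undecided \<sigma>. \<not> win v}"
    using fin' by (auto simp: undecided_def split: if_splits)
  have win_ne: "stem (\<sigma>1 u) \<noteq> stem (\<sigma>1 v)" if "win u" "win v" "u \<in> neighbors I v" for u v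
  proof
    assume eq: "stem (\<sigma>1 u) = stem (\<sigma>1 v)"
    have "u \<in> conflicts \<sigma>1 v" "v \<in> conflicts \<sigma>1 u"
      using that eq win_und neighbors_sym[of u I v] by (auto simp: conflicts_def undecided_def fin1)
    then have "\<not> v < u" "\<not> u < v" using that by (auto simp: win_def)
    then show False using that(3) not_neighbor_self[OF wf] by (metis linorder_neqE_nat)
  qed
  show "consistent \<sigma>'"
    unfolding consistent_def
  proof (intro conjI ballI allI impI)
    fix v c assume v: "v \<in> nodes I" and c: "final_color (\<sigma>' v) = Some c"
    have old: "final_color (\<sigma> v) = Some c \<Longrightarrow> c \<in> palette I v \<and> (\<forall>u\<in>neighbors I v. final_color (\<sigma> u) \<noteq> Some c)"
      using good v by (simp add: consistent_def)
    show "c \<in> palette I v"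
      using c fin'[OF v] old cand(2)[of v] win_und[of v] by (auto simp: remaining_def split: if_splits)
    fix u assume u: "u \<in> neighbors I v"
    have un: "u \<in> nodes I" using u neighbors_subset by auto
    have vu: "v \<in> neighbors I u" using u neighbors_sym by simp
    show "final_color (\<sigma>' u) \<noteq> Some c"
    proof
      assume c': "final_color (\<sigma>' u) = Some c"
      \<comment> \<open>Two adjacent winners differ by \<open>win_ne\<close>. In the mixed cases the
        winner's color lies in \<open>remaining\<close>, which excludes the colors of neighbors
        decided earlier.\<close>
      consider "win v" "win u" | "win v" "\<not> win u" | "\<not> win v" "win u" | "\<not> win v" "\<not> win u" by blast
      then show False
      proof cases
        case 1
        then show False using win_ne[OF _ _ u] c c' fin'[OF v] fin'[OF un] by simp
      next
        case 2
        then show False using cand(2)[OF win_und] c c' fin'[OF v] fin'[OF un] u by (auto simp: remaining_def)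
      next
        case 3
        then show False using cand(2)[OF win_und] c c' fin'[OF v] fin'[OF un] vu by (auto simp: remaining_def)
      next
        case 4
        then show False using old c c' fin'[OF v] fin'[OF un] u by simp
      qed
    qed
  next
    fix v assume v: "v \<in> undecided \<sigma>'"
    then have v0: "v \<in> undecided \<sigma>" and vn: "v \<in> nodes I" using und' undecided_subset by auto
    let ?W = "{u \<in> neighbors I v. win u}"
    have fW: "finite ?W" using finite_neighbors by simp
    have "remaining \<sigma>' v = remaining \<sigma> v - (\<lambda>u. stem (\<sigma>1 u)) ` ?W"
    proof -
      have "(\<exists>u\<in>neighbors I v. final_color (\<sigma>' u) = Some c) \<longleftrightarrow>
          (\<exists>u\<in>neighbors I v. final_color (\<sigma> u) = Some c) \<or> c \<in> (\<lambda>u. stem (\<sigma>1 u)) ` ?W" for c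
      proof -
        have "final_color (\<sigma>' u) = Some c \<longleftrightarrow> final_color (\<sigma> u) = Some c \<or> win u \<and> stem (\<sigma>1 u) = c"
          if "u \<in> neighbors I v" for u
        proof -
          have "u \<in> nodes I" using that neighbors_subset by blast
          then show ?thesis using fin'[of u] win_und[of u] by (auto simp: undecided_def)
        qed
        then show ?thesis by auto
      qed
      then show ?thesis by (auto simp: remaining_def)
    qed
    then have "card (remaining \<sigma> v) - card ((\<lambda>u. stem (\<sigma>1 u)) ` ?W) \<le> card (remaining \<sigma>' v)"
      using fW by (simp add: diff_card_le_card_Diff)
    moreover have "card ((\<lambda>u. stem (\<sigma>1 u)) ` ?W) \<le> card ?W" using fW by (rule card_image_le)
    moreover have "card (neighbors I v \<inter> undecided \<sigma>) < card (remaining \<sigma> v)"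
      using good v0 by (simp add: consistent_def)
    moreover have "card (neighbors I v \<inter> undecided \<sigma>) = card (neighbors I v \<inter> undecided \<sigma>') + card ?W"
    proof -
      have "neighbors I v \<inter> undecided \<sigma> = (neighbors I v \<inter> undecided \<sigma>') \<union> ?W"
        using und' win_und by auto
      then show ?thesis
        using finite_neighbors und' by (simp, intro card_Un_disjoint) auto
    qed
    ultimately show "card (neighbors I v \<inter> undecided \<sigma>') < card (remaining \<sigma>' v)" by linarith
  qed
  let ?U = "undecided \<sigma>"
  have half: "(\<Sum>v\<in>?U. \<Sum>u\<in>conflicts \<sigma>1 v. if v < u then 1 else 0) =
      (\<Sum>v\<in>?U. \<Sum>u\<in>conflicts \<sigma>1 v. if u < v then 1 else (0::real))"
    using sum_conflicts_swap[of "\<lambda>u v. if v < u then 1 else 0" \<sigma>1] by (simp add: und1)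
  have "2 * (\<Sum>v\<in>?U. \<Sum>u\<in>conflicts \<sigma>1 v. if v < u then 1 else (0::real)) =
      (\<Sum>v\<in>?U. \<Sum>u\<in>conflicts \<sigma>1 v. (if v < u then 1 else 0) + (if u < v then 1 else 0))"
    unfolding sum.distrib using half by simp
  also have "\<dots> = (\<Sum>v\<in>?U. \<Sum>u\<in>conflicts \<sigma>1 v. 1)"
    using not_neighbor_self[OF wf] by (intro sum.cong refl) (auto simp: conflicts_def)
  \<comment> \<open>All candidate sets are singletons now, so each ordered pair has energy
    2.\<close>
  also have "2 * \<dots> = energy \<sigma>1 0"
    unfolding energy_def und1 sum_distrib_left
  proof (intro sum.cong refl, goal_cases)
    case (1 v u)
    then have "u \<in> ?U" using conflicts_subset[of \<sigma>1 v] und1 by auto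
    then show ?case using 1 by (simp add: cand(1))
  qed
  finally have four: "4 * (\<Sum>v\<in>?U. \<Sum>u\<in>conflicts \<sigma>1 v. if v < u then 1 else (0::real)) = energy \<sigma>1 0"
    by simp
  have "real (card (undecided \<sigma>')) = (\<Sum>v\<in>?U. if win v then 0 else 1)"
    unfolding und' using finite_undecided by (simp add: sum.If_cases Int_def)
  also have "\<dots> \<le> (\<Sum>v\<in>?U. \<Sum>u\<in>conflicts \<sigma>1 v. if v < u then 1 else (0::real))"
  proof (rule sum_mono, goal_cases)
    case (1 v)
    show ?case
    proof (cases "win v")
      case True
      then show ?thesis by (auto intro: sum_nonneg)
    next
      case False
      then obtain u where "u \<in> conflicts \<sigma>1 v" "v < u" using 1 by (auto simp: win_def)
      then show ?thesis
        using member_le_sum[of u "conflicts \<sigma>1 v" "\<lambda>u. if v < u then 1 else (0::real)"]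
          finite_conflicts False by auto
    qed
  qed
  finally have "4 * real (card (undecided \<sigma>')) \<le> energy \<sigma>1 0" using four by simp
  also have "\<dots> \<le> (1 + 3 * clip L) ^ L * energy (apply_rule I start_rule \<sigma>) L"
    using run_levels(3)[OF start(2)] by (simp add: \<sigma>1_def)
  also have "\<dots> \<le> 3 / 2 * (2 * real (card ?U))"
  proof (rule mult_mono[OF energy_factor start(3)])
    show "0 \<le> energy (apply_rule I start_rule \<sigma>) L"
      unfolding energy_def by (intro sum_nonneg) auto
  qed simp
  finally have "real (4 * card (undecided \<sigma>')) \<le> real (3 * card ?U)" by simp
  then show "4 * card (undecided \<sigma>') \<le> 3 * card ?U" by (simp only: of_nat_le_iff)
qed

end

text \<open>\<open>3 * L\<close> phases suffice since \<open>(3 / 4) ^ (3 * L) * 2 ^ L < 1\<close>.\<close>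

definition program :: "nat \<Rightarrow> (nat \<Rightarrow> nat \<Rightarrow> nat) \<Rightarrow> node_state rule list" where
  "program L code = concat (replicate (3 * L) (phase L code))"

section \<open>Length of the program and size of a message\<close>

lemma length_levels: "length (levels L code j) = j * (num_slots L + 3)"
  by (induction j) (simp_all add: level_def)

lemma length_program: "length (program L code) = 3 * L * (L * (num_slots L + 3) + 2)"
  by (simp add: program_def length_concat sum_list_replicate phase_def length_levels)

text \<open>A finite set that contains all states ever broadcast. Its size \<open>2 ^ O(L)\<close>
  lets a whole state fit into one message of \<open>O(L)\<close> bits.\<close>

definition state_space :: "nat \<Rightarrow> node_state set" where
  "state_space L = {x. final_color x \<in> insert None (Some ` {..<2 ^ L}) \<and> stem x < 2 ^ L \<and>
     low_count x \<le> 2 ^ L \<and> high_count x \<le> 2 ^ L \<and> time_slot x < num_slots L}"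

lemma num_slots_eq: "num_slots L = 331776 * L ^ 5"
  by (simp add: num_slots_def word_length_def alphabet_size_def power_numeral_reduce)

lemma num_slots_le: "num_slots L \<le> 2 ^ (19 + 5 * L)"
proof -
  have "L ^ 5 \<le> (2 ^ L) ^ 5" by (rule power_mono[OF less_imp_le[OF less_exp]]) simp
  then have "331776 * L ^ 5 \<le> 2 ^ 19 * (2 ^ L) ^ 5" by (intro mult_mono) auto
  then show ?thesis by (simp add: num_slots_eq power_add power_mult mult.commute[of 5])
qed

lemma card_state_space: "finite (state_space L)" "card (state_space L) \<le> 2 ^ (9 * L + 24)"
proof -
  let ?f = "\<lambda>(c, s, l, h, t, b). \<lparr>final_color = c, stem = s, low_count = l, high_count = h, time_slot = t, next_bit = b\<rparr>"
  let ?P = "insert None (Some ` {..<2 ^ L :: nat}) \<times> {..<2 ^ L :: nat} \<times> {..2 ^ L :: nat} \<times> {..2 ^ L :: nat} \<times> {..<num_slots L} \<times> (UNIV :: bool option set)"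
  have "state_space L \<subseteq> ?f ` ?P"
  proof
    fix x assume "x \<in> state_space L"
    then have "(final_color x, stem x, low_count x, high_count x, time_slot x, next_bit x) \<in> ?P"
      by (simp add: state_space_def)
    moreover have "x = ?f (final_color x, stem x, low_count x, high_count x, time_slot x, next_bit x)"
      by simp
    ultimately show "x \<in> ?f ` ?P" by (rule rev_image_eqI)
  qed
  moreover have fin: "finite ?P" by simp
  ultimately show "finite (state_space L)" by (meson finite_imageI finite_subset)
  have "card (UNIV :: bool option set) = 3" by (simp add: UNIV_option_conv UNIV_bool)
  then have "card ?P = (2 ^ L + 1) * (2 ^ L * ((2 ^ L + 1) * ((2 ^ L + 1) * (num_slots L * 3))))"
    by (simp add: card_cartesian_product card_image)
  moreover have "card (state_space L) \<le> card ?P"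
    using surj_card_le[OF fin \<open>state_space L \<subseteq> ?f ` ?P\<close>] .
  ultimately have "card (state_space L) \<le> (2 ^ L + 1) * (2 ^ L * ((2 ^ L + 1) * ((2 ^ L + 1) * (num_slots L * 3))))"
    by simp
  \<comment> \<open>Here \<open>2 ^ L + 1 \<le> 2 ^ (L + 1)\<close> serves the optional color and
    the two counts, and \<open>3 \<le> 2 ^ 2\<close> the values of \<open>next_bit\<close>.\<close>
  also have "\<dots> \<le> 2 ^ (L + 1) * (2 ^ L * (2 ^ (L + 1) * (2 ^ (L + 1) * (2 ^ (19 + 5 * L) * 2 ^ 2))))"
    using num_slots_le by (intro mult_mono) auto
  also have "\<dots> = 2 ^ (9 * L + 24)"
    by (simp only: power_add[symmetric]) simp
  finally show "card (state_space L) \<le> 2 ^ (9 * L + 24)" .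
qed

lemma ex_bit_encoding:
  assumes "finite S" "card S \<le> 2 ^ B"
  shows "\<exists>enc :: 'a \<Rightarrow> bool list. inj_on enc S \<and> (\<forall>x\<in>S. length (enc x) = B)"
proof -
  let ?W = "{xs :: bool list. set xs \<subseteq> UNIV \<and> length xs = B}"
  have "finite ?W" by (rule finite_lists_length_eq) simp
  moreover have "card S \<le> card ?W"
    using assms(2) by (subst card_lists_length_eq) (simp_all add: card_UNIV_bool)
  ultimately obtain enc where "enc ` S \<subseteq> ?W" "inj_on enc S"
    using card_le_inj[OF assms(1)] by blast
  then show ?thesis by blast
qed

section \<open>Iterating the phases within the state space\<close>

context coloring_network
begin

lemma run_phases:
  assumes "consistent \<sigma>"
  shows "consistent (run I (concat (replicate r (phase L code))) \<sigma>)"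
    and "4 ^ r * card (undecided (run I (concat (replicate r (phase L code))) \<sigma>)) \<le> 3 ^ r * card (undecided \<sigma>)"
proof -
  have "consistent (run I (concat (replicate r (phase L code))) \<sigma>) \<and>
    4 ^ r * card (undecided (run I (concat (replicate r (phase L code))) \<sigma>)) \<le> 3 ^ r * card (undecided \<sigma>)"
    using assms
  proof (induction r arbitrary: \<sigma>)
    case (Suc r)
    let ?\<sigma> = "run I (phase L code) \<sigma>"
    let ?\<sigma>' = "run I (concat (replicate r (phase L code))) ?\<sigma>"
    note IH = Suc.IH[OF run_phase(1)[OF Suc.prems]]
    have "4 * (4 ^ r * card (undecided ?\<sigma>')) \<le> 4 * (3 ^ r * card (undecided ?\<sigma>))"
      using IH by simp
    also have "\<dots> \<le> 3 ^ r * (3 * card (undecided \<sigma>))"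
      using run_phase(2)[OF Suc.prems] by simp
    finally show ?case using IH by (simp add: mult_ac)
  qed simp
  then show "consistent (run I (concat (replicate r (phase L code))) \<sigma>)"
    and "4 ^ r * card (undecided (run I (concat (replicate r (phase L code))) \<sigma>)) \<le> 3 ^ r * card (undecided \<sigma>)"
    by blast+
qed

lemma run_program:
  assumes "\<forall>v\<in>nodes I. card (palette I v) \<ge> degree I v + 1" and "card (nodes I) \<le> 2 ^ L"
    and \<phi>: "\<And>v. v \<in> nodes I \<Longrightarrow> \<phi> v = the (final_color (run I (program L code) (\<lambda>_. initial_state) v))"
  shows "list_coloring I \<phi>"
proof -
  let ?\<sigma> = "\<lambda>_ :: nat. initial_state"
  let ?\<sigma>' = "run I (program L code) ?\<sigma>"
  have und: "undecided ?\<sigma> = nodes I" by (simp add: undecided_def initial_state_def)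
  have "remaining ?\<sigma> v = palette I v" "neighbors I v \<inter> nodes I = neighbors I v" for v
    using neighbors_subset by (auto simp: remaining_def initial_state_def)
  then have "consistent ?\<sigma>"
    using assms(1) by (auto simp: consistent_def und) (auto simp: initial_state_def degree_def)
  note result = run_phases[OF this, of "3 * L", folded program_def, unfolded und]
  \<comment> \<open>Three phases shrink the undecided set by the factor
    \<open>27 / 64 < 1 / 2\<close>, so \<open>L\<close> such triples leave less than one of at most
    \<open>2 ^ L\<close> nodes.\<close>
  have "(4 ^ 3) ^ L * card (undecided ?\<sigma>') \<le> (3 ^ 3) ^ L * card (nodes I)"
    using result(2) by (simp add: power_mult)
  also have "\<dots> \<le> (3 ^ 3) ^ L * 2 ^ L" using assms(2) by simp
  also have "\<dots> = 54 ^ L" by (simp flip: power_mult_distrib)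
  also have "\<dots> < (4 ^ 3) ^ L" using L by (intro power_strict_mono) auto
  finally have "card (undecided ?\<sigma>') = 0" by simp
  then have "undecided ?\<sigma>' = {}" using finite_undecided by simp
  then have fin: "final_color (?\<sigma>' v) = Some (\<phi> v)" if "v \<in> nodes I" for v
    using that \<phi>[OF that] by (auto simp: undecided_def)
  show ?thesis
    unfolding list_coloring_def
  proof (intro conjI ballI allI impI)
    fix v assume "v \<in> nodes I"
    then show "\<phi> v \<in> palette I v" using result(1) fin by (simp add: consistent_def)
  next
    fix u v assume "{u, v} \<in> edges I"
    then have u: "u \<in> neighbors I v" by (simp add: neighbors_def)
    then have "u \<in> nodes I" "v \<in> nodes I"
      using neighbors_subset neighbors_sym[of u I v] by blast+
    then have "final_color (?\<sigma>' u) \<noteq> Some (\<phi> v)"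
      using result(1) fin[OF \<open>v \<in> nodes I\<close>] u \<open>v \<in> nodes I\<close> unfolding consistent_def by blast
    then show "\<phi> u \<noteq> \<phi> v" using fin \<open>u \<in> nodes I\<close> by auto
  qed
qed

text \<open>Proved for arbitrary states of the space and for all nodes, since decided nodes keep
  applying the rules and their messages have to be decoded as well.\<close>

lemma rule_preserves_state_space:
  assumes f: "f \<in> set (program L code)" and \<sigma>: "\<And>v. v \<in> nodes I \<Longrightarrow> \<sigma> v \<in> state_space L"
    and v: "v \<in> nodes I"
  shows "apply_rule I f \<sigma> v \<in> state_space L"
proof -
  have set_levels: "set (levels L code j) = (\<Union>i<j. set (level L code i))" for j
    by (induction j) (auto simp: less_Suc_eq)
  have "f \<in> set (phase L code)" using f by (auto simp: program_def split: if_splits)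
  then consider "f = start_rule" | "f = resolve_rule" | j where "f = count_rule j" | "f = slot_rule L code"
    | \<tau> where "f = decide_rule L \<tau>" | "f = commit_rule L"
    by (auto simp: phase_def set_levels level_def)
  then show ?thesis
  proof cases
    case 1
    then show ?thesis using \<sigma>[OF v] by (simp add: apply_start state_space_def)
  next
    case 2
    then show ?thesis using \<sigma>[OF v] by (simp add: apply_resolve state_space_def)
  next
    case (3 j)
    have "card {c \<in> remaining \<sigma> v. P c} \<le> 2 ^ L" for P
      using card_mono[of "{..<2 ^ L}" "{c \<in> remaining \<sigma> v. P c}"] remaining_less[OF v, of \<sigma>] by auto
    then show ?thesis using 3 \<sigma>[OF v] by (simp add: apply_count state_space_def)
  next
    case 4
    have "apply_rule I (slot_rule L code) \<sigma> v =
        (\<sigma> v)\<lparr>time_slot := time_slot (apply_rule I (slot_rule L code) \<sigma> v)\<rparr>"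
      by (simp add: apply_slot)
    then show ?thesis using 4 \<sigma>[OF v] slot_bound[OF v, of \<sigma>] by (simp add: state_space_def apply_slot)
  next
    case (5 \<tau>)
    then show ?thesis using \<sigma>[OF v] by (simp add: apply_decide state_space_def)
  next
    case 6
    then show ?thesis using \<sigma>[OF v] by (simp add: apply_commit state_space_def)
  qed
qed

lemma run_in_state_space:
  assumes "set fs \<subseteq> set (program L code)" "v \<in> nodes I"
  shows "run I fs (\<lambda>_. initial_state) v \<in> state_space L"
  using assms
proof (induction fs arbitrary: v rule: rev_induct)
  case Nil
  then show ?case using L by (simp add: state_space_def initial_state_def num_slots_eq)
next
  case (snoc f fs)
  then show ?case using rule_preserves_state_space[of f "run I fs (\<lambda>_. initial_state)" v] by simp
qed

end

section \<open>Round and bandwidth bounds\<close>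

text \<open>The shift by 1 keeps the logarithm nonnegative, also for \<open>x = 0\<close>.\<close>

definition bit_size :: "nat \<Rightarrow> nat" where "bit_size x = nat \<lceil>log 2 (real x + 1)\<rceil>"

lemma le_two_power_bit_size: "x \<le> 2 ^ bit_size x"
proof -
  have "real x + 1 = 2 powr log 2 (real x + 1)" by simp
  also have "\<dots> \<le> 2 powr real (bit_size x)"
    unfolding bit_size_def by (intro powr_mono) (auto intro: real_nat_ceiling_ge)
  also have "\<dots> = real (2 ^ bit_size x)" by (simp add: powr_realpow)
  finally show ?thesis by linarith
qed

lemma one_le_ln: "n \<ge> 3 \<Longrightarrow> 1 \<le> ln (real n)"
  using exp_le by (subst ln_ge_iff) auto

lemma const_bigo_ln: "(\<lambda>_. c :: real) \<in> O(\<lambda>n. ln (real n))"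
proof (rule bigoI)
  show "\<forall>\<^sub>F n in sequentially. norm c \<le> \<bar>c\<bar> * norm (ln (real n))"
    using eventually_ge_at_top[of 3]
  proof eventually_elim
    case (elim n)
    then show ?case using one_le_ln[OF elim] mult_left_mono[of 1 "ln (real n)" "\<bar>c\<bar>"] by simp
  qed
qed

lemma bit_size_bigo_ln:
  assumes "(\<lambda>n. real (f n)) \<in> O(\<lambda>n. real n ^ k)"
  shows "(\<lambda>n. real (bit_size (f n))) \<in> O(\<lambda>n. ln (real n))"
proof -
  obtain c where c: "c > 0" "\<forall>\<^sub>F n in sequentially. norm (real (f n)) \<le> c * norm (real n ^ k)"
    using landau_o.bigE[OF assms] by blast
  \<comment> \<open>The \<open>c + 1\<close> comes from
    \<open>f n + 1 \<le> (c + 1) * n ^ k\<close>, the division by \<open>ln 2\<close> from the base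
    of the logarithm, and the last 1 pays for the ceiling. Constants are absorbed by
    \<open>ln n \<ge> 1\<close>, valid from \<open>n = 3\<close> on.\<close>
  let ?C = "(ln (c + 1) + real k) / ln 2 + 1"
  have "\<forall>\<^sub>F n in sequentially. norm (real (bit_size (f n))) \<le> ?C * norm (ln (real n))"
    using c(2) eventually_ge_at_top[of 3]
  proof eventually_elim
    case (elim n)
    have ln1: "1 \<le> ln (real n)" by (rule one_le_ln[OF elim(2)])
    have "real (f n) + 1 \<le> c * real n ^ k + real n ^ k"
      using elim by (intro add_mono) (auto simp: one_le_power)
    also have "\<dots> = (c + 1) * real n ^ k" by (simp add: algebra_simps)
    finally have "ln (real (f n) + 1) \<le> ln ((c + 1) * real n ^ k)"
      using c(1) by (intro ln_mono) auto
    also have "\<dots> = ln (c + 1) + real k * ln (real n)"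
      using c(1) elim(2) by (simp add: ln_mult ln_realpow)
    also have "\<dots> \<le> ln (c + 1) * ln (real n) + real k * ln (real n)"
      using ln1 c(1) mult_left_mono[OF ln1, of "ln (c + 1)"] by simp
    finally have "ln (real (f n) + 1) \<le> (ln (c + 1) + real k) * ln (real n)"
      by (simp add: algebra_simps)
    then have "log 2 (real (f n) + 1) \<le> (ln (c + 1) + real k) * ln (real n) / ln 2"
      by (simp add: log_def divide_right_mono)
    moreover have "log 2 (real (f n) + 1) \<ge> 0" by simp
    then have "real (bit_size (f n)) \<le> log 2 (real (f n) + 1) + 1"
      unfolding bit_size_def by linarith
    ultimately have "real (bit_size (f n)) \<le> (ln (c + 1) + real k) / ln 2 * ln (real n) + ln (real n)"
      using ln1 by simp
    then show ?case using ln1 by (simp add: algebra_simps)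
  qed
  then show ?thesis by (rule bigoI)
qed

theorem corollary1p2:
  fixes id_bits color_bound :: "nat \<Rightarrow> nat" and k :: nat
  assumes "(\<lambda>n. real (id_bits n)) \<in> O(\<lambda>n. ln (real n))"
    and "(\<lambda>n. real (color_bound n)) \<in> O(\<lambda>n. real n ^ k)"
  shows "\<exists>(A :: congest_algorithm) (bandwidth :: nat \<Rightarrow> nat) (rounds :: nat \<Rightarrow> nat).
    (\<lambda>n. real (bandwidth n)) \<in> O(\<lambda>n. ln (real n)) \<and>
    (\<lambda>n. real (rounds n)) \<in> O(\<lambda>n. ln (real n) ^ 8) \<and>
    (\<forall>(I :: coloring_instance) n.
       well_formed I \<and> n = card (nodes I) \<and>
       nodes I \<subseteq> {0..<2 ^ id_bits n} \<and>
       num_colors I \<le> color_bound n \<and>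
       (\<forall>v \<in> nodes I. card (palette I v) \<ge> degree I v + 1) \<longrightarrow>
       respects_bandwidth A I (rounds n) (bandwidth n) \<and>
       list_coloring I (output_after A I (rounds n)))"
proof -
  \<comment> \<open>One length for identifiers, colors and the number of nodes; the final 1 makes it
    positive. It depends on \<open>n\<close> alone, so all nodes know it.\<close>
  define L where "L n = id_bits n + bit_size (color_bound n) + bit_size n + 1" for n
  have L_pos: "L n > 0" for n by (simp add: L_def)
  have const: "(\<lambda>_. c) \<in> O(\<lambda>n. ln (real n))" for c :: real
    using const_bigo_ln .
  have "(\<lambda>n. real n) \<in> O(\<lambda>n. real n ^ 1)" by simp
  then have L_bigo: "(\<lambda>n. real (L n)) \<in> O(\<lambda>n. ln (real n))"
    unfolding L_def of_nat_add using assms(1) bit_size_bigo_ln[OF assms(2)] bit_size_bigo_ln[of "\<lambda>n. n" 1] const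
    by (intro sum_in_bigo) auto
  have "\<exists>code. separating_code (L n) code" for n by (rule ex_separating_code[OF L_pos])
  \<comment> \<open>The code, like the encoding below, is fixed for each \<open>n\<close>
    independently of the instance, so the nodes share it without communication.\<close>
  then obtain code where code: "\<And>n. separating_code (L n) (code n)" by metis
  have "\<exists>enc :: node_state \<Rightarrow> bool list. inj_on enc (state_space (L n)) \<and>
      (\<forall>x\<in>state_space (L n). length (enc x) = 9 * L n + 24)" for n
    by (rule ex_bit_encoding[OF card_state_space])
  then obtain enc :: "nat \<Rightarrow> node_state \<Rightarrow> bool list" where
    enc: "\<And>n. inj_on (enc n) (state_space (L n))"
      "\<And>n x. x \<in> state_space (L n) \<Longrightarrow> length (enc n x) = 9 * L n + 24" by metis
  define prog where "prog n = program (L n) (code n)" for n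
  define A where "A = broadcast_algorithm prog initial_state (\<lambda>n. state_space (L n)) enc (\<lambda>x. the (final_color x))"
  define bandwidth where "bandwidth n = 9 * L n + 24" for n
  define rounds where "rounds n = length (prog n)" for n
  have "(\<lambda>n. real (bandwidth n)) \<in> O(\<lambda>n. ln (real n))"
    using L_bigo const by (auto simp: bandwidth_def intro!: sum_in_bigo)
  moreover have "(\<lambda>n. real (rounds n)) \<in> O(\<lambda>n. ln (real n) ^ 8)"
  proof -
    \<comment> \<open>The exact number of rounds has degree 7 in \<open>L n\<close>; all powers are
      raised to the 8 of the claim, and \<open>995343 = 995328 + 9 + 6\<close>, where
      \<open>995328 = 3 * 576\<^sup>2\<close>.\<close>
    have "rounds n \<le> 995343 * L n ^ 8" for n
    proof -
      have p: "L n ^ i \<le> L n ^ 8" if "i \<le> 8" for i using that L_pos[of n] by (intro power_increasing) auto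
      have "rounds n = 995328 * L n ^ 7 + 9 * L n ^ 2 + 6 * L n ^ 1"
        by (simp add: rounds_def prog_def length_program num_slots_eq power_numeral_reduce algebra_simps)
      also have "\<dots> \<le> 995328 * L n ^ 8 + 9 * L n ^ 8 + 6 * L n ^ 8"
        by (intro add_mono mult_left_mono p) auto
      finally show ?thesis by simp
    qed
    then have "real (rounds n) \<le> 995343 * real (L n) ^ 8" for n
      by (metis of_nat_le_iff of_nat_mult of_nat_numeral of_nat_power)
    then have "(\<lambda>n. real (rounds n)) \<in> O(\<lambda>n. real (L n) ^ 8)"
      by (intro bigoI[where c = 995343] always_eventually) auto
    also have "(\<lambda>n. real (L n) ^ 8) \<in> O(\<lambda>n. ln (real n) ^ 8)"
      by (rule landau_o.big_power[OF L_bigo])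
    finally show ?thesis .
  qed
  moreover have "respects_bandwidth A I (rounds n) (bandwidth n) \<and> list_coloring I (output_after A I (rounds n))"
    if I: "well_formed I" "n = card (nodes I)" "nodes I \<subseteq> {0..<2 ^ id_bits n}"
      "num_colors I \<le> color_bound n" "\<forall>v\<in>nodes I. card (palette I v) \<ge> degree I v + 1" for I n
  proof -
    have pow: "x \<le> 2 ^ m \<Longrightarrow> m \<le> L n \<Longrightarrow> x \<le> 2 ^ L n" for x m :: nat
      by (erule order.trans) (simp add: power_increasing)
    interpret coloring_network I "L n" "code n"
    proof
      have "(2::nat) ^ id_bits n \<le> 2 ^ L n" by (rule pow[OF order.refl]) (simp add: L_def)
      then have "{0..<2 ^ id_bits n} \<subseteq> {..<2 ^ L n :: nat}"
        unfolding lessThan_atLeast0 by (rule ivl_subset[THEN iffD2, OF disjI2, OF conjI[OF order.refl]])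
      then show "nodes I \<subseteq> {..<2 ^ L n}" using I(3) by (rule order.trans[rotated])
      show "num_colors I \<le> 2 ^ L n"
        using I(4) le_two_power_bit_size[of "color_bound n"]
        by (intro pow[of _ "bit_size (color_bound n)"]) (auto simp: L_def)
    qed (use I(1) L_pos code in auto)
    have in_space: "run I (take t (prog n)) (\<lambda>_. initial_state) v \<in> state_space (L n)"
      if "v \<in> nodes I" for t v
      by (rule run_in_state_space[OF _ that]) (simp add: prog_def set_take_subset)
    note correct = broadcast_algorithm_correct[where prog = prog and S = "\<lambda>n. state_space (L n)" and enc = enc
        and out = "\<lambda>x. the (final_color x)" and B = "bandwidth n", OF I(1,2) rounds_def[of n] in_space enc(1),
        folded A_def]
    have "respects_bandwidth A I (rounds n) (bandwidth n)"
      by (rule correct(1)) (simp_all add: enc(2) bandwidth_def)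
    moreover have "list_coloring I (output_after A I (rounds n))"
    proof (rule run_program[OF I(5)])
      show "card (nodes I) \<le> 2 ^ L n"
        using le_two_power_bit_size[of n] I(2) by (intro pow[of _ "bit_size n"]) (auto simp: L_def)
      show "output_after A I (rounds n) v =
          the (final_color (run I (program (L n) (code n)) (\<lambda>_. initial_state) v))" if "v \<in> nodes I" for v
        using correct(2)[OF _ _ that] enc(2) by (simp add: bandwidth_def prog_def)
    qed
    ultimately show ?thesis ..
  qed
  ultimately show ?thesis by blast
qed

end
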